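(* There is an algorithm that decides, for any hypersequent, whether or not it has a derivation in $\mathbf{HMR}$.
   Context: Terms. Fix a countable set of variables $x,y,\dots$. Terms (in negation normal form) are generated by $A ::= x \mid \overline{x} \mid 0 \mid 1 \mid \overline{1} \mid A+A \mid rA \mid A\sqcup A \mid A\sqcap A \mid \Diamond A$ with $r\in\mathbb{R}_{>0}$. Negation: $\overline{x}$ for $x$, $\overline{\overline{x}}=x$, $\overline{0}=0$, $\overline 1$ for $1$, $\overline{\overline{1}}=1$, $\overline{A+B}=\overline A+\overline B$, $\overline{rA}=r\overline A$, $\overline{A\sqcup B}=\overline A\sqcap\overline B$, $\overline{A\sqcap B}=\overline A\sqcup\overline B$, $\overline{\Diamond A}=\Diamond\overline A$. A weighted term is $r.A$ ($r>0$); a sequent $\vdash\Gamma$ has $\Gamma$ a finite (possibly empty) multiset of weighted terms; a hypersequent is a nonempty finite multiset of sequents $\vdash\Gamma_1\mid\cdots\mid\vdash\Gamma_n$; $G\mid\vdash\Gamma$ adds a sequent. For a finite (possibly empty) sequence $\vec r=(r_1,\dots,r_n)$ of positive reals, $\vec r.A$ is the multiset $r_1.A,\dots,r_n.A$, $\sum\vec r=r_1+\dots+r_n$, $s\vec r=(sr_1,\dots,sr_n)$; $s.\Gamma$ multiplies all weights by $s>0$; if $\Gamma=r_1.A_1,\dots,r_n.A_n$ then $\Diamond\Gamma=r_1.\Diamond A_1,\dots,r_n.\Diamond A_n$. The calculus $\mathbf{HMR}$ has the rules: INIT: $\vdash$ with no premises. W: from $G$ infer $G\mid\vdash\Gamma$.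 C: from $G\mid\vdash\Gamma\mid\vdash\Gamma$ infer $G\mid\vdash\Gamma$. S: from $G\mid\vdash\Gamma_1,\Gamma_2$ infer $G\mid\vdash\Gamma_1\mid\vdash\Gamma_2$. M: from $G\mid\vdash\Gamma_1$ and $G\mid\vdash\Gamma_2$ infer $G\mid\vdash\Gamma_1,\Gamma_2$. T: for $r>0$, from $G\mid\vdash r.\Gamma$ infer $G\mid\vdash\Gamma$. ID: if $\sum\vec r=\sum\vec s$, from $G\mid\vdash\Gamma$ infer $G\mid\vdash\Gamma,\vec r.x,\vec s.\overline{x}$ ($x$ a variable). 0: from $G\mid\vdash\Gamma$ infer $G\mid\vdash\Gamma,\vec r.0$. $+$: from $G\mid\vdash\Gamma,\vec r.A,\vec r.B$ infer $G\mid\vdash\Gamma,\vec r.(A+B)$. $\times$: from $G\mid\vdash\Gamma,(s\vec r).A$ infer $G\mid\vdash\Gamma,\vec r.(sA)$. $\sqcup$: from $G\mid\vdash\Gamma,\vec r.A\mid\vdash\Gamma,\vec r.B$ infer $G\mid\vdash\Gamma,\vec r.(A\sqcup B)$. $\sqcap$: from $G\mid\vdash\Gamma,\vec r.A$ and $G\mid\vdash\Gamma,\vec r.B$ infer $G\mid\vdash\Gamma,\vec r.(A\sqcap B)$. CAN: if $\sum\vec r=\sum\vec s$, from $G\mid\vdash\Gamma,\vec s.A,\vec r.\overline A$ infer $G\mid\vdash\Gamma$. 1: if $\sum\vec r\geq\sum\vec s$, from $G\mid\vdash\Gamma$ infer $G\mid\vdash\Gamma,\vec r.1,\vec s.\overline{1}$.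 $\Diamond$: if $\sum\vec r\geq\sum\vec s$, from the single-sequent hypersequent $\vdash\Gamma,\vec r.1,\vec s.\overline 1$ infer the single-sequent hypersequent $\vdash\Diamond\Gamma,\vec r.1,\vec s.\overline 1$. A derivation is a finite tree of rule instances whose leaves are INIT. *)

theory Defs
  imports Complex_Main "HOL-Library.Multiset"
begin

section \<open>Terms, sequents and the calculus HMR\<close>

typedef posreal = "{r :: real. r > 0}"
  morphisms real_of Posreal
  by (rule exI[of _ 1]) simp

definition pmul :: "posreal \<Rightarrow> posreal \<Rightarrow> posreal"
  where "pmul r s = Posreal (real_of r * real_of s)"

lemma real_of_pmul: "real_of (pmul r s) = real_of r * real_of s"
  using real_of[of r] real_of[of s] by (simp add: pmul_def Posreal_inverse)

text \<open>Terms are in negation normal form: \<open>CoVar x\<close> and \<open>NegOne\<close> are the negated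
  atoms. Variables are indexed by natural numbers.\<close>

datatype trm =
    Var nat
  | CoVar nat
  | Zero
  | One
  | NegOne
  | Plus trm trm
  | Scale posreal trm
  | Join trm trm
  | Meet trm trm
  | Dia trm

primrec neg :: "trm \<Rightarrow> trm" where
  "neg (Var x) = CoVar x"
| "neg (CoVar x) = Var x"
| "neg Zero = Zero"
| "neg One = NegOne"
| "neg NegOne = One"
| "neg (Plus A B) = Plus (neg A) (neg B)"
| "neg (Scale r A) = Scale r (neg A)"
| "neg (Join A B) = Meet (neg A) (neg B)"
| "neg (Meet A B) = Join (neg A) (neg B)"
| "neg (Dia A) = Dia (neg A)"

type_synonym sequent = "(posreal \<times> trm) multiset"
type_synonym hypersequent = "sequent multiset"

definition weighted :: "posreal list \<Rightarrow> trm \<Rightarrow> sequent"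
  where "weighted rs A = mset (map (\<lambda>r. (r, A)) rs)"

definition total :: "posreal list \<Rightarrow> real"
  where "total rs = sum_list (map real_of rs)"

definition scale_seq :: "posreal \<Rightarrow> sequent \<Rightarrow> sequent"
  where "scale_seq s \<Gamma> = image_mset (\<lambda>(r, A). (pmul s r, A)) \<Gamma>"

definition dia_seq :: "sequent \<Rightarrow> sequent"
  where "dia_seq \<Gamma> = image_mset (\<lambda>(r, A). (r, Dia A)) \<Gamma>"

text \<open>The side hypersequent \<open>G\<close> of a rule may be the empty multiset, so that the rules
  apply to single-sequent hypersequents. Every derivable multiset is nonempty, see
  \<open>HMR_nonempty\<close> below; in particular the premise of rule \<open>W\<close> is a hypersequent.\<close>

inductive HMR :: "hypersequent \<Rightarrow> bool" where
  INIT: "HMR {#{#}#}"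
| W: "HMR G \<Longrightarrow> HMR (add_mset \<Gamma> G)"
| C: "HMR (add_mset \<Gamma> (add_mset \<Gamma> G)) \<Longrightarrow> HMR (add_mset \<Gamma> G)"
| S: "HMR (add_mset (\<Gamma>1 + \<Gamma>2) G) \<Longrightarrow> HMR (add_mset \<Gamma>1 (add_mset \<Gamma>2 G))"
| M: "HMR (add_mset \<Gamma>1 G) \<Longrightarrow> HMR (add_mset \<Gamma>2 G) \<Longrightarrow> HMR (add_mset (\<Gamma>1 + \<Gamma>2) G)"
| T: "HMR (add_mset (scale_seq r \<Gamma>) G) \<Longrightarrow> HMR (add_mset \<Gamma> G)"
| ID: "total rs = total ss \<Longrightarrow> HMR (add_mset \<Gamma> G) \<Longrightarrow>
    HMR (add_mset (\<Gamma> + weighted rs (Var x) + weighted ss (CoVar x)) G)"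
| Zero: "HMR (add_mset \<Gamma> G) \<Longrightarrow> HMR (add_mset (\<Gamma> + weighted rs Zero) G)"
| Plus: "HMR (add_mset (\<Gamma> + weighted rs A + weighted rs B) G) \<Longrightarrow>
    HMR (add_mset (\<Gamma> + weighted rs (Plus A B)) G)"
| Times: "HMR (add_mset (\<Gamma> + weighted (map (pmul s) rs) A) G) \<Longrightarrow>
    HMR (add_mset (\<Gamma> + weighted rs (Scale s A)) G)"
| Join: "HMR (add_mset (\<Gamma> + weighted rs A) (add_mset (\<Gamma> + weighted rs B) G)) \<Longrightarrow>
    HMR (add_mset (\<Gamma> + weighted rs (Join A B)) G)"
| Meet: "HMR (add_mset (\<Gamma> + weighted rs A) G) \<Longrightarrow> HMR (add_mset (\<Gamma> + weighted rs B) G) \<Longrightarrow>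
    HMR (add_mset (\<Gamma> + weighted rs (Meet A B)) G)"
| CAN: "total rs = total ss \<Longrightarrow>
    HMR (add_mset (\<Gamma> + weighted ss A + weighted rs (neg A)) G) \<Longrightarrow> HMR (add_mset \<Gamma> G)"
| One: "total rs \<ge> total ss \<Longrightarrow> HMR (add_mset \<Gamma> G) \<Longrightarrow>
    HMR (add_mset (\<Gamma> + weighted rs One + weighted ss NegOne) G)"
| Dia: "total rs \<ge> total ss \<Longrightarrow>
    HMR {#\<Gamma> + weighted rs One + weighted ss NegOne#} \<Longrightarrow>
    HMR {#dia_seq \<Gamma> + weighted rs One + weighted ss NegOne#}"

lemma HMR_nonempty: "HMR G \<Longrightarrow> G \<noteq> {#}"
  by (induction rule: HMR.induct) auto

section \<open>Algorithms on data containing real numbers\<close>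

text \<open>Weights and scalars are arbitrary real numbers, so algorithms are understood as in
  the Blum-Shub-Smale model: exact field operations and comparison of reals are elementary
  steps. They are given as finite programs of a first-order functional language
  (call by value, unrestricted recursion) on binary trees with real leaves.

  Unlike in the original Blum-Shub-Smale model, the only numeric constant of the language is
  \<open>1\<close>. A program with an arbitrary real constant could decide any set of natural numbers,
  by reading off the digits of that constant. Here a program is a finite object without
  reals, and on trees with rational leaves all numbers occurring in its run are rational, so
  that on such inputs it is an algorithm in the ordinary (Turing) sense.\<close>

datatype data = Null | Num real | Pair data data

datatype unop = Fst | Snd | IsNum | IsPair

datatype binop = Cons | Add | Sub | Mul | Div | Less

datatype expr =
    Arg nat
  | NullE
  | OneE
  | Unary unop expr
  | Binary binop expr expr
  | If expr expr expr
  | Call nat "expr list"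

definition truth :: "bool \<Rightarrow> data"
  where "truth b = (if b then Num 1 else Null)"

fun apply_unop :: "unop \<Rightarrow> data \<Rightarrow> data" where
  "apply_unop Fst (Pair u v) = u"
| "apply_unop Snd (Pair u v) = v"
| "apply_unop IsNum (Num a) = truth True"
| "apply_unop IsPair (Pair u v) = truth True"
| "apply_unop _ _ = Null"

fun apply_binop :: "binop \<Rightarrow> data \<Rightarrow> data \<Rightarrow> data" where
  "apply_binop Cons u v = Pair u v"
| "apply_binop Add (Num a) (Num b) = Num (a + b)"
| "apply_binop Sub (Num a) (Num b) = Num (a - b)"
| "apply_binop Mul (Num a) (Num b) = Num (a * b)"
| "apply_binop Div (Num a) (Num b) = Num (a / b)"
| "apply_binop Less (Num a) (Num b) = truth (a < b)"
| "apply_binop _ _ _ = Null"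

text \<open>A program is the list of bodies of its (mutually recursive) functions, which are
  called by their position in the list; \<open>Arg i\<close> is the \<open>i\<close>-th argument of the current call.\<close>

type_synonym program = "expr list"

inductive eval :: "program \<Rightarrow> data list \<Rightarrow> expr \<Rightarrow> data \<Rightarrow> bool"
  for P :: program where
  Arg: "i < length env \<Longrightarrow> eval P env (Arg i) (env ! i)"
| NullE: "eval P env NullE Null"
| OneE: "eval P env OneE (Num 1)"
| Unary: "eval P env e v \<Longrightarrow> eval P env (Unary f e) (apply_unop f v)"
| Binary: "eval P env e1 v1 \<Longrightarrow> eval P env e2 v2 \<Longrightarrow> eval P env (Binary f e1 e2) (apply_binop f v1 v2)"
| IfTrue: "eval P env e u \<Longrightarrow> u \<noteq> Null \<Longrightarrow> eval P env e1 v \<Longrightarrow> eval P env (If e e1 e2) v"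
| IfFalse: "eval P env e Null \<Longrightarrow> eval P env e2 v \<Longrightarrow> eval P env (If e e1 e2) v"
| Call: "f < length P \<Longrightarrow> list_all2 (eval P env) es vs \<Longrightarrow> eval P vs (P ! f) v \<Longrightarrow>
    eval P env (Call f es) v"

inductive_cases eval_elims:
  "eval P env (Arg i) w"
  "eval P env NullE w"
  "eval P env OneE w"
  "eval P env (Unary f e) w"
  "eval P env (Binary f e1 e2) w"
  "eval P env (If e e1 e2) w"
  "eval P env (Call f es) w"

lemma eval_deterministic: "eval P env e v \<Longrightarrow> eval P env e w \<Longrightarrow> v = w"
proof (induction arbitrary: w rule: eval.induct)
  case (Arg i env)
  from Arg.prems show ?case by (rule eval_elims(1)) simp
next
  case (NullE env)
  from NullE.prems show ?case by (rule eval_elims(2)) simp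
next
  case (OneE env)
  from OneE.prems show ?case by (rule eval_elims(3)) simp
next
  case (Unary env e v f)
  from Unary.prems show ?case by (rule eval_elims(4)) (simp add: Unary.IH)
next
  case (Binary env e1 v1 e2 v2 f)
  from Binary.prems show ?case by (rule eval_elims(5)) (metis Binary.IH)
next
  case (IfTrue env e u e1 v e2)
  from IfTrue.prems show ?case by (rule eval_elims(6)) (metis IfTrue.IH IfTrue.hyps)+
next
  case (IfFalse env e e2 v e1)
  from IfFalse.prems show ?case by (rule eval_elims(6)) (metis IfFalse.IH)+
next
  case (Call f env es vs v)
  from Call.prems obtain vs' where
    *: "list_all2 (eval P env) es vs'" "eval P vs' (P ! f) w"
    by (rule eval_elims(7))
  have "vs = vs'"
    using Call.IH(1) *(1) by (auto simp: list_all2_conv_all_nth intro: nth_equalityI)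
  then show ?case using Call.IH(2) *(2) by blast
qed

text \<open>The program halts on input \<open>d\<close> with output \<open>v\<close>; function \<open>0\<close> is the main function.\<close>

definition computes :: "program \<Rightarrow> data \<Rightarrow> data \<Rightarrow> bool"
  where "computes P d v \<longleftrightarrow> P \<noteq> [] \<and> eval P [d] (P ! 0) v"

section \<open>Hypersequents as inputs\<close>

definition enc_nat :: "nat \<Rightarrow> data"
  where "enc_nat n = Num (real n)"

primrec enc_list :: "data list \<Rightarrow> data" where
  "enc_list [] = Null"
| "enc_list (d # ds) = Pair d (enc_list ds)"

primrec enc_trm :: "trm \<Rightarrow> data" where
  "enc_trm (Var x) = Pair (enc_nat 0) (enc_nat x)"
| "enc_trm (CoVar x) = Pair (enc_nat 1) (enc_nat x)"
| "enc_trm Zero = Pair (enc_nat 2) Null"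
| "enc_trm One = Pair (enc_nat 3) Null"
| "enc_trm NegOne = Pair (enc_nat 4) Null"
| "enc_trm (Plus A B) = Pair (enc_nat 5) (Pair (enc_trm A) (enc_trm B))"
| "enc_trm (Scale r A) = Pair (enc_nat 6) (Pair (Num (real_of r)) (enc_trm A))"
| "enc_trm (Join A B) = Pair (enc_nat 7) (Pair (enc_trm A) (enc_trm B))"
| "enc_trm (Meet A B) = Pair (enc_nat 8) (Pair (enc_trm A) (enc_trm B))"
| "enc_trm (Dia A) = Pair (enc_nat 9) (enc_trm A)"

text \<open>A program receives a hypersequent as a list of lists of weighted terms, and has to
  give the right answer for every such listing.\<close>

type_synonym hyperlist = "(posreal \<times> trm) list list"

definition hyperseq_of :: "hyperlist \<Rightarrow> hypersequent"
  where "hyperseq_of H = mset (map mset H)"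

definition enc_weighted :: "posreal \<times> trm \<Rightarrow> data"
  where "enc_weighted = (\<lambda>(r, A). Pair (Num (real_of r)) (enc_trm A))"

definition enc_hyper :: "hyperlist \<Rightarrow> data"
  where "enc_hyper H = enc_list (map (\<lambda>\<Gamma>. enc_list (map enc_weighted \<Gamma>)) H)"

lemma hyperseq_of_surj: "\<exists>H. hyperseq_of H = G"
proof (induction G)
  case empty
  show ?case by (rule exI[of _ "[]"]) (simp add: hyperseq_of_def)
next
  case (add \<Gamma> G)
  then obtain H where H: "hyperseq_of H = G" by blast
  obtain xs where "mset xs = \<Gamma>" using ex_mset by blast
  then have "hyperseq_of (xs # H) = add_mset \<Gamma> G" using H by (simp add: hyperseq_of_def)
  then show ?case by blast
qed

end

theory Submission
  imports Defs
begin

text \<open>A hypersequent is derivable iff it is valid in all finite weighted trees (states), where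
  \<open>1\<close> is the mass of a state and \<open>\<Diamond>\<close> sums over the children. For completeness, the logical
  rules are invertible and reduce the claim to terms on which evaluation is linear; a variant of
  Farkas' lemma then merges two sequents into one, and a single valid sequent comes from a valid
  sequent of smaller modal depth by the rule \<open>\<Diamond>\<close>. For decidability, up to a given modal depth
  the cone of all states has finitely many generators: the double description method cuts the cone
  into finitely many cones on which all subterms are linear, and making the generators of these
  into children yields the generators for the next depth. Validity is thus checked on finitely
  many states, with field operations and comparisons only.\<close>

section \<open>States and soundness\<close>

text \<open>The rules C, S, M and T leave proof search with unboundedly many copies and arbitrary
  real multipliers. The multiplier \<open>t\<close> of \<open>farkas_max\<close> is a supremum: it
  has to exist, but nothing computes it, so completeness alone yields no algorithm. On the semantic
  side the obstacle is that states have unbounded depth and branching, and that a child enters its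
  parent through a function \<open>val B\<close> that need not be linear. The remedy: up to a given
  depth, a parent sees of a child only its mass and the values of finitely many subterms. On a cone
  where all of these are linear, a child that is a combination of generators can be traded for
  several children that are generators, with the coefficients as weights, and finitely many
  candidates remain. A child is an opaque atom of a formal sum, and states are not identified with
  each other, so no evaluation has to respect a quotient; where two lists represent the same sum,
  this is stated by \<open>same_sum\<close>.\<close>

text \<open>A state is a formal sum of its mass, its coordinates (the values of the variables) and its
  children. Addition of states is concatenation. A child contributes its own mass to the state, so
  that \<open>\<Diamond>1 \<le> 1\<close> holds by construction.\<close>

datatype atom = Mass | Coord nat | Child "(real \<times> atom) list"

type_synonym state = "(real \<times> atom) list"

definition lin :: "(atom \<Rightarrow> real) \<Rightarrow> state \<Rightarrow> real"
  where "lin f m = (\<Sum>(w, a)\<leftarrow>m. w * f a)"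

lemma lin_simps [simp]:
  "lin f [] = 0"
  "lin f ((w, a) # m) = w * f a + lin f m"
  "lin f (m @ m') = lin f m + lin f m'"
  by (simp_all add: lin_def)

definition scale :: "real \<Rightarrow> state \<Rightarrow> state"
  where "scale c m = map (\<lambda>(w, a). (c * w, a)) m"

lemma scale_simps [simp]:
  "scale c [] = []"
  "scale c ((w, a) # m) = (c * w, a) # scale c m"
  "scale c (m @ m') = scale c m @ scale c m'"
  by (simp_all add: scale_def)

lemma lin_scale [simp]: "lin f (scale c m) = c * lin f m"
  by (induction m) (auto simp: algebra_simps)

fun mass :: "atom \<Rightarrow> real" where
  "mass Mass = 1"
| "mass (Coord i) = 0"
| "mass (Child m) = (\<Sum>(w, a)\<leftarrow>m. w * mass a)"

lemma mass_Child: "mass (Child m) = lin mass m"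
  by (simp add: lin_def)

declare mass.simps(3) [simp del] mass_Child [simp]

section \<open>Values of terms and sequents at a state\<close>

primrec val :: "trm \<Rightarrow> state \<Rightarrow> real" where
  "val (Var i) = lin (\<lambda>a. if a = Coord i then 1 else 0)"
| "val (CoVar i) = (\<lambda>m. - lin (\<lambda>a. if a = Coord i then 1 else 0) m)"
| "val Zero = (\<lambda>m. 0)"
| "val One = lin mass"
| "val NegOne = (\<lambda>m. - lin mass m)"
| "val (Plus A B) = (\<lambda>m. val A m + val B m)"
| "val (Scale r A) = (\<lambda>m. real_of r * val A m)"
| "val (Join A B) = (\<lambda>m. max (val A m) (val B m))"
| "val (Meet A B) = (\<lambda>m. min (val A m) (val B m))"
| "val (Dia A) = lin (\<lambda>a. case a of Child c \<Rightarrow> val A c | _ \<Rightarrow> 0)"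

text \<open>Coordinates may have either sign because a variable ranges over all reals. The weight of
  \<open>Mass\<close> is the share of the mass that lies in no child, so that \<open>Dia One\<close>
  can be strictly smaller than \<open>One\<close>.\<close>

inductive state :: "state \<Rightarrow> bool" where
  Nil: "state []"
| Mass: "state m \<Longrightarrow> w \<ge> 0 \<Longrightarrow> state ((w, Mass) # m)"
| Coord: "state m \<Longrightarrow> state ((w, Coord i) # m)"
| Child: "state m \<Longrightarrow> state c \<Longrightarrow> w \<ge> 0 \<Longrightarrow> state ((w, Child c) # m)"

lemma state_append: "state m \<Longrightarrow> state m' \<Longrightarrow> state (m @ m')"
  by (induction rule: state.induct) (auto intro: state.intros)

lemma state_scale: "state m \<Longrightarrow> c \<ge> 0 \<Longrightarrow> state (scale c m)"
  by (induction rule: state.induct) (auto intro: state.intros)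

lemma lin_mass_nonneg: "state m \<Longrightarrow> lin mass m \<ge> 0"
  by (induction rule: state.induct) auto

lemma real_of_pos [simp]: "real_of r > 0"
  using real_of[of r] by simp

lemma real_of_nonneg [simp]: "real_of r \<ge> 0"
  by (simp add: less_imp_le)

lemma real_of_mult_nonneg_iff [simp]: "0 \<le> real_of r * x \<longleftrightarrow> 0 \<le> x"
  using mult_le_cancel_left_pos[OF real_of_pos, of r 0 x] by simp

lemma val_neg [simp]: "val (neg A) m = - val A m"
proof (induction A arbitrary: m)
  case (Dia A)
  have "lin (\<lambda>a. case a of Child c \<Rightarrow> val (neg A) c | _ \<Rightarrow> 0) m =
      - lin (\<lambda>a. case a of Child c \<Rightarrow> val A c | _ \<Rightarrow> 0) m"
    by (induction m) (auto simp: Dia split: atom.split)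
  then show ?case by simp
qed auto

lemma val_scale [simp]: "c \<ge> 0 \<Longrightarrow> val A (scale c m) = c * val A m"
  by (induction A) (auto simp: algebra_simps max_mult_distrib_left min_mult_distrib_left)

definition seqval :: "sequent \<Rightarrow> state \<Rightarrow> real"
  where "seqval \<Gamma> m = (\<Sum>(r, A)\<in>#\<Gamma>. real_of r * val A m)"

lemma seqval_simps [simp]:
  "seqval {#} m = 0"
  "seqval (add_mset (r, A) \<Gamma>) m = real_of r * val A m + seqval \<Gamma> m"
  "seqval (\<Gamma> + \<Delta>) m = seqval \<Gamma> m + seqval \<Delta> m"
  by (simp_all add: seqval_def)

lemma seqval_weighted [simp]: "seqval (weighted rs A) m = total rs * val A m"
  by (induction rs) (auto simp: weighted_def total_def algebra_simps)

lemma seqval_scale_seq [simp]: "seqval (scale_seq s \<Gamma>) m = real_of s * seqval \<Gamma> m"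
  by (induction \<Gamma>) (auto simp: scale_seq_def real_of_pmul algebra_simps)

lemma total_map_pmul [simp]: "total (map (pmul s) rs) = real_of s * total rs"
  by (induction rs) (auto simp: total_def real_of_pmul algebra_simps)

lemma total_nonneg: "total rs \<ge> 0"
  by (induction rs) (auto simp: total_def)

lemma seqval_scale: "c \<ge> 0 \<Longrightarrow> seqval \<Gamma> (scale c m) = c * seqval \<Gamma> m"
  by (induction \<Gamma>) (auto simp: algebra_simps)

lemma seqval_dia_seq:
  "seqval (dia_seq \<Gamma>) m = lin (\<lambda>a. case a of Child c \<Rightarrow> seqval \<Gamma> c | _ \<Rightarrow> 0) m"
proof (induction m)
  case Nil
  show ?case by (induction \<Gamma>) (auto simp: dia_seq_def)
next
  case (Cons p m)
  obtain w a where p: "p = (w, a)" by (cases p)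
  have "seqval (dia_seq \<Gamma>) ((w, a) # m) =
      w * (case a of Child c \<Rightarrow> seqval \<Gamma> c | _ \<Rightarrow> 0) + seqval (dia_seq \<Gamma>) m"
    by (induction \<Gamma>) (auto simp: dia_seq_def algebra_simps split: atom.splits)
  then show ?case using Cons p by simp
qed

definition valid :: "hypersequent \<Rightarrow> bool"
  where "valid G \<longleftrightarrow> (\<forall>m. state m \<longrightarrow> (\<exists>\<Gamma>\<in>#G. seqval \<Gamma> m \<ge> 0))"

text \<open>Here \<open>k\<close> is the surplus of \<open>One\<close> over \<open>NegOne\<close> in
  the rule for \<open>Dia\<close>. The premise pays for each child, weighted by \<open>w\<close>;
  the mass outside the children adds \<open>k * w\<close>, which is where the side condition of the
  rule enters.\<close>

lemma dia_nonneg: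
  assumes "\<And>c. state c \<Longrightarrow> seqval \<Gamma> c + k * lin mass c \<ge> 0" "k \<ge> 0" "state m"
  shows "seqval (dia_seq \<Gamma>) m + k * lin mass m \<ge> 0"
  using assms(3) unfolding seqval_dia_seq
proof (induction rule: state.induct)
  case (Mass m w)
  have "k * w \<ge> 0" using assms(2) Mass by simp
  then show ?case using Mass by (simp add: algebra_simps)
next
  case (Child m c w)
  have "w * (seqval \<Gamma> c + k * lin mass c) \<ge> 0" using assms(1) Child by simp
  then show ?case using Child by (simp add: algebra_simps)
qed auto

theorem HMR_sound: "HMR G \<Longrightarrow> valid G"
proof (induction rule: HMR.induct)
  case (M \<Gamma>1 G \<Gamma>2)
  then show ?case unfolding valid_def by (auto 4 4)
next
  case (S \<Gamma>1 \<Gamma>2 G)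
  show ?case unfolding valid_def
  proof (intro allI impI)
    fix m assume "state m"
    then have "seqval \<Gamma>1 m + seqval \<Gamma>2 m \<ge> 0 \<or> (\<exists>\<Gamma>\<in>#G. seqval \<Gamma> m \<ge> 0)"
      using S unfolding valid_def by simp
    then have "seqval \<Gamma>1 m \<ge> 0 \<or> seqval \<Gamma>2 m \<ge> 0 \<or> (\<exists>\<Gamma>\<in>#G. seqval \<Gamma> m \<ge> 0)"
      by linarith
    then show "\<exists>\<Gamma>\<in>#add_mset \<Gamma>1 (add_mset \<Gamma>2 G). seqval \<Gamma> m \<ge> 0" by auto
  qed
next
  case (T r \<Gamma> G)
  then show ?case unfolding valid_def by simp
next
  case (One rs ss \<Gamma> G)
  show ?case unfolding valid_def
  proof (intro allI impI)
    fix m assume m: "state m"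
    have "total ss * lin mass m \<le> total rs * lin mass m"
      using One lin_mass_nonneg[OF m] by (simp add: mult_right_mono)
    then show "\<exists>\<Delta>\<in>#add_mset (\<Gamma> + weighted rs One + weighted ss NegOne) G. seqval \<Delta> m \<ge> 0"
      using One m unfolding valid_def by fastforce
  qed
next
  case (Dia rs ss \<Gamma>)
  have *: "seqval (\<Gamma> + weighted rs One + weighted ss NegOne) m =
      seqval \<Gamma> m + (total rs - total ss) * lin mass m" for \<Gamma> m
    by (simp add: algebra_simps)
  show ?case using Dia dia_nonneg[of \<Gamma> "total rs - total ss"] unfolding valid_def
    by (simp del: seqval_simps add: *)
next
  case (Join \<Gamma> rs A B G)
  then show ?case unfolding valid_def
    by (auto simp: max_mult_distrib_left total_nonneg max_add_distrib_right le_max_iff_disj)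
next
  case (Meet \<Gamma> rs A B G)
  then show ?case unfolding valid_def by (auto simp: min_def)
qed (auto simp: valid_def algebra_simps)

section \<open>Completeness\<close>

lemma HMR_weaken: "HMR G \<Longrightarrow> HMR (G + H)"
  by (induction H) (auto intro: HMR.W)

text \<open>Rule \<open>S\<close> detaches \<Delta> from one sequent of \<open>G\<close> at a time,
  and the detached copy is contracted with the one already present. The sequents treated so far
  collect in \<open>H\<close>.\<close>

lemma HMR_split_off:
  "HMR (image_mset (\<lambda>\<Gamma>. \<Gamma> + \<Delta>) G + add_mset \<Delta> H) \<Longrightarrow> HMR (G + add_mset \<Delta> H)"
proof (induction G arbitrary: H)
  case (add \<Gamma> G)
  have "HMR (add_mset \<Gamma> (add_mset \<Delta> (image_mset (\<lambda>\<Gamma>. \<Gamma> + \<Delta>) G + add_mset \<Delta> H)))"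
    using add.prems by (intro HMR.S) (simp add: add_mset_commute)
  then have "HMR (add_mset \<Delta> (add_mset \<Delta> (add_mset \<Gamma> (image_mset (\<lambda>\<Gamma>. \<Gamma> + \<Delta>) G + H))))"
    by (simp add: add_mset_commute)
  then have "HMR (add_mset \<Delta> (add_mset \<Gamma> (image_mset (\<lambda>\<Gamma>. \<Gamma> + \<Delta>) G + H)))"
    by (rule HMR.C)
  then have "HMR (image_mset (\<lambda>\<Gamma>. \<Gamma> + \<Delta>) G + add_mset \<Delta> (add_mset \<Gamma> H))"
    by (simp add: add_mset_commute)
  from add.IH[OF this] show ?case by (simp add: add_mset_commute)
qed simp

lemma weighted_simps [simp]:
  "weighted [] A = {#}"
  "weighted (r # rs) A = add_mset (r, A) (weighted rs A)"
  by (simp_all add: weighted_def)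

section \<open>Measures, and removal of the outer connectives\<close>

primrec mdepth :: "trm \<Rightarrow> nat" where
  "mdepth (Var i) = 0"
| "mdepth (CoVar i) = 0"
| "mdepth Zero = 0"
| "mdepth One = 0"
| "mdepth NegOne = 0"
| "mdepth (Plus A B) = max (mdepth A) (mdepth B)"
| "mdepth (Scale r A) = mdepth A"
| "mdepth (Join A B) = max (mdepth A) (mdepth B)"
| "mdepth (Meet A B) = max (mdepth A) (mdepth B)"
| "mdepth (Dia A) = Suc (mdepth A)"

text \<open>The number of logical rules that apply to a term before the rule \<open>\<Diamond>\<close>.\<close>

primrec outer :: "trm \<Rightarrow> nat" where
  "outer (Var i) = 0"
| "outer (CoVar i) = 0"
| "outer Zero = 1"
| "outer One = 0"
| "outer NegOne = 0"
| "outer (Plus A B) = Suc (outer A + outer B)"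
| "outer (Scale r A) = Suc (outer A)"
| "outer (Join A B) = Suc (outer A + outer B)"
| "outer (Meet A B) = Suc (outer A + outer B)"
| "outer (Dia A) = 0"

definition seq_depth_le :: "nat \<Rightarrow> sequent \<Rightarrow> bool"
  where "seq_depth_le d \<Gamma> \<longleftrightarrow> (\<forall>p\<in>#\<Gamma>. mdepth (snd p) \<le> d)"

definition basic :: "sequent \<Rightarrow> bool"
  where "basic \<Gamma> \<longleftrightarrow> (\<forall>p\<in>#\<Gamma>. outer (snd p) = 0)"

lemma seq_depth_le_simps [simp]:
  "seq_depth_le d {#}"
  "seq_depth_le d (add_mset p \<Gamma>) \<longleftrightarrow> mdepth (snd p) \<le> d \<and> seq_depth_le d \<Gamma>"
  "seq_depth_le d (\<Gamma> + \<Delta>) \<longleftrightarrow> seq_depth_le d \<Gamma> \<and> seq_depth_le d \<Delta>"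
  "seq_depth_le d (scale_seq s \<Gamma>) \<longleftrightarrow> seq_depth_le d \<Gamma>"
  "seq_depth_le (Suc d) (dia_seq \<Gamma>) \<longleftrightarrow> seq_depth_le d \<Gamma>"
  by (auto simp: seq_depth_le_def scale_seq_def dia_seq_def)

lemma seq_depth_le_0_dia_seq [simp]: "seq_depth_le 0 (dia_seq \<Gamma>) \<longleftrightarrow> \<Gamma> = {#}"
  by (cases \<Gamma>) (auto simp: dia_seq_def)

lemma seq_depth_le_weighted [simp]: "mdepth A \<le> d \<Longrightarrow> seq_depth_le d (weighted rs A)"
  by (induction rs) auto

lemma basic_simps [simp]:
  "basic {#}"
  "basic (add_mset p \<Gamma>) \<longleftrightarrow> outer (snd p) = 0 \<and> basic \<Gamma>"
  "basic (\<Gamma> + \<Delta>) \<longleftrightarrow> basic \<Gamma> \<and> basic \<Delta>"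
  "basic (scale_seq s \<Gamma>) \<longleftrightarrow> basic \<Gamma>"
  by (auto simp: basic_def scale_seq_def)

text \<open>A child is a single atom of the sum, so a term under \<open>Dia\<close> may be nonlinear
  without disturbing additivity at the parent.\<close>

lemma val_append_outer_0: "outer A = 0 \<Longrightarrow> val A (m @ m') = val A m + val A m'"
  by (cases A) auto

lemma basic_seqval_append: "basic \<Gamma> \<Longrightarrow> seqval \<Gamma> (m @ m') = seqval \<Gamma> m + seqval \<Gamma> m'"
  by (induction \<Gamma>) (auto simp: val_append_outer_0 algebra_simps)

text \<open>\<open>Join\<close> replaces a sequent by two whose exponents are smaller by at least
  one. Base 3 makes this a strict decrease; with base 2 equality could occur.\<close>

definition hyper_outer :: "hypersequent \<Rightarrow> nat"
  where "hyper_outer G = (\<Sum>\<Gamma>\<in>#G. 3 ^ (\<Sum>p\<in>#\<Gamma>. outer (snd p)))"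

lemma hyper_outer_simps [simp]:
  "hyper_outer (add_mset \<Gamma> G) = 3 ^ (\<Sum>p\<in>#\<Gamma>. outer (snd p)) + hyper_outer G"
  by (simp add: hyper_outer_def)

text \<open>The logical rules are semantically invertible, so validity passes from the conclusion to
  every premise, and the premises keep the depth bound. One occurrence is treated at a time, hence
  the list \<open>[r]\<close>.\<close>

lemma complete_reduce:
  assumes basic_case: "\<And>G. valid G \<Longrightarrow> \<forall>\<Gamma>\<in>#G. seq_depth_le d \<Gamma> \<and> basic \<Gamma> \<Longrightarrow> HMR G"
    and "valid G" "\<forall>\<Gamma>\<in>#G. seq_depth_le d \<Gamma>"
  shows "HMR G"
  using assms(2,3)
proof (induction "hyper_outer G" arbitrary: G rule: less_induct)
  case less
  show ?case
  proof (cases "\<forall>\<Gamma>\<in>#G. basic \<Gamma>")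
    case True
    then show ?thesis using basic_case less by blast
  next
    case False
    then obtain \<Gamma>' r A where "\<Gamma>' \<in># G" "(r, A) \<in># \<Gamma>'" and A: "outer A \<noteq> 0"
      unfolding basic_def by auto
    then obtain \<Gamma> G' where G: "G = add_mset (add_mset (r, A) \<Gamma>) G'"
      by (metis multi_member_split)
    have d: "mdepth A \<le> d" "seq_depth_le d \<Gamma>" "\<forall>\<Gamma>\<in>#G'. seq_depth_le d \<Gamma>"
      using less.prems G by auto
    show ?thesis
    proof (cases A)
      case Zero
      have "HMR (add_mset \<Gamma> G')"
        using less.prems d unfolding G Zero
        by (intro less.hyps) (auto simp: valid_def G Zero)
      from HMR.Zero[OF this, of "[r]"] show ?thesis by (simp add: G Zero)
    next
      case (Plus B C)
      have "HMR (add_mset (\<Gamma> + weighted [r] B + weighted [r] C) G')"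
        using less.prems d unfolding G Plus
        by (intro less.hyps) (auto simp: valid_def G Plus algebra_simps)
      from HMR.Plus[OF this] show ?thesis by (simp add: G Plus)
    next
      case (Scale s B)
      have "HMR (add_mset (\<Gamma> + weighted (map (pmul s) [r]) B) G')"
        using less.prems d unfolding G Scale
        by (intro less.hyps) (auto simp: valid_def G Scale real_of_pmul algebra_simps)
      from HMR.Times[OF this] show ?thesis by (simp add: G Scale)
    next
      case (Join B C)
      let ?n = "(\<Sum>p\<in>#\<Gamma>. outer (snd p))"
      have "(3::nat) ^ (outer B + ?n) \<le> 3 ^ (outer B + outer C + ?n)"
        "(3::nat) ^ (outer C + ?n) \<le> 3 ^ (outer B + outer C + ?n)"
        by (intro power_increasing; simp)+
      then have "(3::nat) ^ (outer B + ?n) + 3 ^ (outer C + ?n) < 3 * 3 ^ (outer B + outer C + ?n)"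
        using zero_less_power[of "3::nat" "outer B + outer C + ?n"] by linarith
      moreover have "valid (add_mset (\<Gamma> + weighted [r] B) (add_mset (\<Gamma> + weighted [r] C) G'))"
        using less.prems(1)
        by (auto simp: valid_def G Join max_mult_distrib_left max_add_distrib_left le_max_iff_disj)
      ultimately have "HMR (add_mset (\<Gamma> + weighted [r] B) (add_mset (\<Gamma> + weighted [r] C) G'))"
        using d unfolding G Join
        by (intro less.hyps) (auto simp: G Join)
      from HMR.Join[OF this] show ?thesis by (simp add: G Join)
    next
      case (Meet B C)
      let ?n = "(\<Sum>p\<in>#\<Gamma>. outer (snd p))"
      have n: "(3::nat) ^ (outer B + ?n) < 3 * 3 ^ (outer B + outer C + ?n)"
        "(3::nat) ^ (outer C + ?n) < 3 * 3 ^ (outer B + outer C + ?n)"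
        unfolding power_Suc[symmetric] by (intro power_strict_increasing; simp)+
      have v: "valid (add_mset (\<Gamma> + weighted [r] B) G')" "valid (add_mset (\<Gamma> + weighted [r] C) G')"
        using less.prems(1)
        by (auto simp: valid_def G Meet min_mult_distrib_left min_add_distrib_left)
      have "HMR (add_mset (\<Gamma> + weighted [r] B) G')"
        using v n d unfolding G Meet by (intro less.hyps) (auto simp: G Meet)
      moreover have "HMR (add_mset (\<Gamma> + weighted [r] C) G')"
        using v n d unfolding G Meet by (intro less.hyps) (auto simp: G Meet)
      ultimately show ?thesis using HMR.Meet[of \<Gamma> "[r]" B G' C] by (simp add: G Meet)
    qed (use A in auto)
  qed
qed

text \<open>Farkas' lemma for two functionals, one of them a maximum: the admissible multipliers
  form an interval bounded by the values of \<open>a\<close> and \<open>b\<close>.\<close>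

lemma farkas_max:
  fixes f :: "state \<Rightarrow> real" and F :: "(state \<Rightarrow> real) set"
  assumes F: "finite F" "F \<noteq> {}"
    and add: "\<And>l m m'. l \<in> insert f F \<Longrightarrow> l (m @ m') = l m + l m'"
    and scale: "\<And>l c m. l \<in> insert f F \<Longrightarrow> c \<ge> 0 \<Longrightarrow> l (scale c m) = c * l m"
    and pos: "\<And>m. state m \<Longrightarrow> f m \<ge> 0 \<or> (\<exists>l\<in>F. l m \<ge> 0)"
    and k: "state k" "f k < 0"
  shows "\<exists>t\<ge>0. \<forall>m. state m \<longrightarrow> (\<exists>l\<in>F. l m + t * f m \<ge> 0)"
proof -
  \<comment> \<open>For \<open>f m > 0\<close> some \<open>l m + t * f m\<close> is nonnegative iff
    \<open>t \<ge> a m\<close>; for \<open>f m < 0\<close> this holds iff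
    \<open>t \<le> b m\<close>. Hence a minimum in one bound and a maximum in the other.\<close>
  define a where "a m = Min ((\<lambda>l. - l m / f m) ` F)" for m
  define b where "b m = Max ((\<lambda>l. l m / (- f m)) ` F)" for m
  \<comment> \<open>The \<open>0\<close> makes \<open>t\<close> nonnegative and the set nonempty;
    the state \<open>k\<close> supplies the upper bound \<open>b k\<close>.\<close>
  define t where "t = Sup (insert 0 (a ` {m. state m \<and> f m > 0}))"
  \<comment> \<open>\<open>pos\<close> says nothing at \<open>m\<close> itself, as
    \<open>f m \<ge> 0\<close> is true there. It is applied to \<open>k\<close> plus a large
    multiple of \<open>m\<close>, where \<open>f\<close> is negative; the factor \<open>s\<close>
    exceeds all \<open>\<bar>l k / l m\<bar>\<close>, so every \<open>l\<close> would be negative as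
    well.\<close>
  have zero: "\<exists>l\<in>F. l m \<ge> 0" if m: "state m" and equal: "f m = 0" for m
  proof (rule ccontr)
    assume neg: "\<not> ?thesis"
    define s where "s = 1 + (\<Sum>l\<in>F. \<bar>l k / l m\<bar>)"
    have s: "s \<ge> 0" unfolding s_def by (intro add_nonneg_nonneg sum_nonneg) auto
    have "f (scale s m @ k) < 0"
      using s k equal add[of f] scale[of f] by (simp del: scale_simps)
    moreover have "state (scale s m @ k)"
      using s m k by (intro state_append state_scale)
    ultimately obtain l where l: "l \<in> F" "l (scale s m @ k) \<ge> 0"
      using pos by (meson not_le)
    have ln: "l m < 0" using neg l equal by auto
    have "\<bar>l k / l m\<bar> \<le> (\<Sum>l\<in>F. \<bar>l k / l m\<bar>)"
      using l F by (intro member_le_sum) auto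
    then have "\<bar>l k\<bar> / (- l m) < s"
      using ln unfolding s_def by (simp add: abs_divide)
    then have "\<bar>l k\<bar> < s * (- l m)"
      using ln by (subst (asm) pos_divide_less_eq) auto
    moreover have "l (scale s m @ k) = s * l m + l k"
      using s l add[of l] scale[of l] by (simp del: scale_simps)
    ultimately show False using l by linarith
  qed
  have ab: "a m \<le> b m'" if m: "state m" "f m > 0" and m': "state m'" "f m' < 0" for m m'
  proof -
    \<comment> \<open>The weights balance \<open>f\<close> to \<open>0\<close>, so that
      \<open>zero\<close> yields one \<open>l\<close> that compares both quotients.\<close>
    let ?n = "scale (- f m') m @ scale (f m) m'"
    have "f ?n = 0" "state ?n"
      using m m' add[of f] scale[of f] by (auto intro!: state_append state_scale)
    then obtain l where l: "l \<in> F" "l ?n \<ge> 0" using zero by blast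
    have "l ?n = (- f m') * l m + f m * l m'"
      using l m m' add[of l] scale[of l] by simp
    then have "- l m / f m \<le> l m' / (- f m')"
      using l m m' by (simp add: field_simps)
    moreover have "a m \<le> - l m / f m" using l F unfolding a_def by (intro Min_le) auto
    moreover have "l m' / (- f m') \<le> b m'" using l F unfolding b_def by (intro Max_ge) auto
    ultimately show ?thesis by linarith
  qed
  have b0: "0 \<le> b m" if m: "state m" "f m < 0" for m
  proof -
    obtain l where l: "l \<in> F" "l m \<ge> 0" using pos[OF m(1)] m by auto
    then have "0 \<le> l m / (- f m)" using m by (simp add: divide_nonneg_neg)
    also have "\<dots> \<le> b m" using l F unfolding b_def by (intro Max_ge) auto
    finally show ?thesis .
  qed
  have bdd: "bdd_above (insert 0 (a ` {m. state m \<and> f m > 0}))"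
    using ab b0 k by (intro bdd_aboveI[of _ "b k"]) auto
  have t0: "t \<ge> 0" unfolding t_def by (rule cSup_upper[OF _ bdd]) simp
  have at: "a m \<le> t" if "state m" "f m > 0" for m
    unfolding t_def by (rule cSup_upper[OF _ bdd]) (use that in auto)
  have tb: "t \<le> b m" if "state m" "f m < 0" for m
    unfolding t_def by (rule cSup_least) (use that ab b0 in auto)
  have "\<exists>l\<in>F. l m + t * f m \<ge> 0" if m: "state m" for m
  proof (cases "f m" "0::real" rule: linorder_cases)
    case less
    have "b m \<in> (\<lambda>l. l m / (- f m)) ` F" unfolding b_def using F by (intro Max_in) auto
    then obtain l where "l \<in> F" "t \<le> l m / (- f m)" using tb[OF m less] by auto
    then show ?thesis using less by (intro bexI[of _ l]) (auto simp: field_simps)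
  next
    case greater
    have "a m \<in> (\<lambda>l. - l m / f m) ` F" unfolding a_def using F by (intro Min_in) auto
    then obtain l where "l \<in> F" "- l m / f m \<le> t" using at[OF m greater] by auto
    then show ?thesis using greater by (intro bexI[of _ l]) (auto simp: field_simps)
  next
    case equal
    then show ?thesis using zero[OF m] by auto
  qed
  then show ?thesis using t0 by blast
qed

text \<open>A sequent that is negative somewhere takes the role of \<open>f\<close>, and its
  multiple by \<open>t\<close> is absorbed into all the others, so that each round removes one
  sequent. In the calculus, \<open>HMR_split_off\<close> and rule \<open>T\<close> undo the
  absorption.\<close>

lemma complete_basic:
  assumes single: "\<And>\<Gamma>. valid {#\<Gamma>#} \<Longrightarrow> seq_depth_le d \<Gamma> \<Longrightarrow> basic \<Gamma> \<Longrightarrow> HMR {#\<Gamma>#}"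
    and "valid G" "\<forall>\<Gamma>\<in>#G. seq_depth_le d \<Gamma> \<and> basic \<Gamma>"
  shows "HMR G"
  using assms(2,3)
proof (induction "size G" arbitrary: G)
  case 0
  then show ?case using state.Nil by (auto simp: valid_def)
next
  case (Suc n)
  then obtain \<Gamma> G' where G: "G = add_mset \<Gamma> G'" by (metis size_eq_Suc_imp_eq_union)
  have \<Gamma>: "seq_depth_le d \<Gamma>" "basic \<Gamma>" and G': "\<forall>\<Gamma>\<in>#G'. seq_depth_le d \<Gamma> \<and> basic \<Gamma>"
    and n: "n = size G'" using Suc G by auto
  consider "valid {#\<Gamma>#}" | k where "state k" "seqval \<Gamma> k < 0" "G' \<noteq> {#}"
  proof (cases "\<forall>m. state m \<longrightarrow> seqval \<Gamma> m \<ge> 0")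
    case True then show ?thesis using that by (simp add: valid_def)
  next
    case False then show ?thesis using that Suc.prems G by (cases "G' = {#}") (auto simp: not_le)
  qed
  then show ?case
  proof cases
    case 1
    then have "HMR {#\<Gamma>#}" using single \<Gamma> by blast
    from HMR_weaken[OF this, of G'] show ?thesis by (simp add: G)
  next
    case 2
    have "\<exists>t\<ge>0. \<forall>m. state m \<longrightarrow> (\<exists>l\<in>seqval ` set_mset G'. l m + t * seqval \<Gamma> m \<ge> 0)"
    proof (rule farkas_max)
      show "seqval \<Gamma> m \<ge> 0 \<or> (\<exists>l\<in>seqval ` set_mset G'. l m \<ge> 0)" if "state m" for m
        using Suc.prems(1) that unfolding valid_def G by auto
    qed (use 2 \<Gamma> G' in \<open>auto simp: basic_seqval_append seqval_scale\<close>)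
    then obtain t where t: "t \<ge> 0"
      "\<And>m. state m \<Longrightarrow> \<exists>\<Gamma>'\<in>#G'. seqval \<Gamma>' m + t * seqval \<Gamma> m \<ge> 0" by auto
    show ?thesis
    proof (cases "t = 0")
      case True
      then have "valid G'" using t by (simp add: valid_def)
      then show ?thesis using Suc.hyps(1)[OF n] G' by (simp add: G HMR.W)
    next
      case False
      define \<Delta> where "\<Delta> = scale_seq (Posreal t) \<Gamma>"
      have "real_of (Posreal t) = t" using t False by (simp add: Posreal_inverse)
      then have "valid (image_mset (\<lambda>\<Gamma>'. \<Gamma>' + \<Delta>) G')"
        using t by (simp add: valid_def \<Delta>_def)
      moreover have "\<forall>\<Gamma>'\<in>#image_mset (\<lambda>\<Gamma>'. \<Gamma>' + \<Delta>) G'. seq_depth_le d \<Gamma>' \<and> basic \<Gamma>'"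
        using \<Gamma> G' by (auto simp: \<Delta>_def)
      ultimately have "HMR (image_mset (\<lambda>\<Gamma>'. \<Gamma>' + \<Delta>) G')"
        using Suc.hyps(1) n by simp
      then have "HMR (image_mset (\<lambda>\<Gamma>'. \<Gamma>' + \<Delta>) G' + add_mset \<Delta> {#})"
        by (simp add: HMR.W)
      from HMR_split_off[OF this] have "HMR (add_mset \<Delta> G')" by simp
      then show ?thesis unfolding \<Delta>_def G by (rule HMR.T)
    qed
  qed
qed

section \<open>Derivations of single valid sequents\<close>

definition only_vars :: "sequent \<Rightarrow> bool"
  where "only_vars \<Theta> \<longleftrightarrow> (\<forall>p\<in>#\<Theta>. \<exists>x. snd p = Var x \<or> snd p = CoVar x)"

lemma basic_decompose:
  "basic \<Gamma> \<Longrightarrow> \<exists>\<Delta> rs ss \<Theta>.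
    \<Gamma> = dia_seq \<Delta> + weighted rs One + weighted ss NegOne + \<Theta> \<and> only_vars \<Theta>"
proof (induction \<Gamma>)
  case empty
  show ?case
    by (intro exI[of _ "{#}"] exI[of _ "[]"]) (simp add: dia_seq_def only_vars_def)
next
  case (add p \<Gamma>)
  then obtain \<Delta> rs ss \<Theta> where IH:
    "\<Gamma> = dia_seq \<Delta> + weighted rs One + weighted ss NegOne + \<Theta>" "only_vars \<Theta>" by auto
  obtain r A where p: "p = (r, A)" by (cases p)
  have "outer A = 0" using add.prems p by simp
  then consider x where "A = Var x \<or> A = CoVar x" | "A = One" | "A = NegOne" | B where "A = Dia B"
    by (cases A) auto
  then show ?case
  proof cases
    case 1
    then show ?thesis using IH p
      by (intro exI[of _ \<Delta>] exI[of _ rs] exI[of _ ss] exI[of _ "add_mset p \<Theta>"])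
        (auto simp: only_vars_def)
  next
    case 2
    then show ?thesis using IH p
      by (intro exI[of _ \<Delta>] exI[of _ "r # rs"] exI[of _ ss] exI[of _ \<Theta>]) simp
  next
    case 3
    then show ?thesis using IH p
      by (intro exI[of _ \<Delta>] exI[of _ rs] exI[of _ "r # ss"] exI[of _ \<Theta>]) simp
  next
    case 4
    then show ?thesis using IH p
      by (intro exI[of _ "add_mset (r, B) \<Delta>"] exI[of _ rs] exI[of _ ss] exI[of _ \<Theta>])
        (simp add: dia_seq_def)
  qed
qed

lemma filter_weighted: "\<exists>rs. filter_mset (\<lambda>p. snd p = A) \<Theta> = weighted rs A"
proof (induction \<Theta>)
  case empty
  show ?case by (intro exI[of _ "[]"]) simp
next
  case (add p \<Theta>)
  then obtain rs where rs: "filter_mset (\<lambda>p. snd p = A) \<Theta> = weighted rs A" by blast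
  show ?case
  proof (cases "snd p = A")
    case True
    then show ?thesis using rs by (intro exI[of _ "fst p # rs"]) auto
  next
    case False
    then show ?thesis using rs by auto
  qed
qed

text \<open>The state \<open>[(1, Coord x)]\<close> reads off the net coefficient of
  \<open>x\<close>. If it vanishes, the positive and negative occurrences of \<open>x\<close> have
  equal totals, which is the side condition of \<open>ID\<close>; one application then accounts for
  all of them.\<close>

lemma HMR_only_vars:
  "HMR {#\<Pi>#} \<Longrightarrow> only_vars \<Theta> \<Longrightarrow> (\<And>x. seqval \<Theta> [(1, Coord x)] = 0) \<Longrightarrow> HMR {#\<Pi> + \<Theta>#}"
proof (induction "size \<Theta>" arbitrary: \<Theta> rule: less_induct)
  case less
  show ?case
  proof (cases "\<Theta> = {#}")
    case True then show ?thesis using less by simp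
  next
    case False
    then obtain p where p: "p \<in># \<Theta>" by auto
    then obtain x where x: "snd p = Var x \<or> snd p = CoVar x"
      using less.prems by (auto simp: only_vars_def)
    define \<Theta>' where "\<Theta>' = filter_mset (\<lambda>p. snd p \<noteq> Var x \<and> snd p \<noteq> CoVar x) \<Theta>"
    obtain rs ss where
      rs: "filter_mset (\<lambda>p. snd p = Var x) \<Theta> = weighted rs (Var x)" and
      ss: "filter_mset (\<lambda>p. snd p = CoVar x) \<Theta> = weighted ss (CoVar x)"
      using filter_weighted by metis
    have \<Theta>: "\<Theta> = \<Theta>' + weighted rs (Var x) + weighted ss (CoVar x)"
      unfolding \<Theta>'_def rs[symmetric] ss[symmetric] by (induction \<Theta>) auto
    have "size \<Theta>' < size \<Theta>"
      unfolding \<Theta>'_def using p x by (intro size_filter_unsat_elem) auto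
    have vars: "only_vars \<Theta>'" using less.prems by (auto simp: only_vars_def \<Theta>'_def)
    have x0: "seqval \<Theta>' [(1, Coord x)] = 0"
      using less.prems(2) unfolding \<Theta>'_def by (induction \<Theta>) (auto simp: only_vars_def)
    have eq: "total rs = total ss" using less.prems(3)[of x] x0 unfolding \<Theta> by simp
    have "seqval \<Theta>' [(1, Coord y)] = 0" for y
      using less.prems(3)[of y] x0 unfolding \<Theta> by (cases "x = y") auto
    then have "HMR {#\<Pi> + \<Theta>'#}"
      using less \<open>size \<Theta>' < size \<Theta>\<close> vars by blast
    from HMR.ID[OF eq this, of x] show ?thesis unfolding \<Theta> by (simp add: add.assoc)
  qed
qed

lemma seqval_only_vars [simp]:
  assumes "only_vars \<Theta>"
  shows "seqval \<Theta> [(w, Mass)] = 0" "seqval \<Theta> [(w, Child c)] = 0"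
    "seqval \<Theta> [(-1, Coord x)] = - seqval \<Theta> [(1, Coord x)]"
  using assms by (induction \<Theta>) (auto simp: only_vars_def)

text \<open>A valid basic sequent is probed by special states. Unit mass gives the side condition of
  rule \<open>Dia\<close>, the two signed unit coordinates force the variables to cancel, and a
  single child \<open>c\<close> transfers validity to the premise of \<open>Dia\<close>.\<close>

theorem HMR_complete: "valid G \<Longrightarrow> \<forall>\<Gamma>\<in>#G. seq_depth_le d \<Gamma> \<Longrightarrow> HMR G"
proof (induction d arbitrary: G)
  \<comment> \<open>Derivability of the premise of \<open>Dia\<close> is kept as an assumption, so
    that one argument serves both cases: at depth 0 there is nothing under \<open>Dia\<close> and
    rule \<open>One\<close> suffices, otherwise the induction hypothesis applies.\<close>
  have *: "HMR {#\<Gamma>#}" if IH: "\<And>\<Delta> rs ss. seq_depth_le d (dia_seq \<Delta>) \<Longrightarrow>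
      valid {#\<Delta> + weighted rs One + weighted ss NegOne#} \<Longrightarrow> total rs \<ge> total ss \<Longrightarrow>
      HMR {#\<Delta> + weighted rs One + weighted ss NegOne#}"
    and v: "valid {#\<Gamma>#}" and d: "seq_depth_le d \<Gamma>" and b: "basic \<Gamma>" for d \<Gamma>
  proof -
    obtain \<Delta> rs ss \<Theta> where \<Gamma>: "\<Gamma> = dia_seq \<Delta> + weighted rs One + weighted ss NegOne + \<Theta>"
      and \<Theta>: "only_vars \<Theta>" using basic_decompose[OF b] by blast
    have pos: "seqval \<Gamma> m \<ge> 0" if "state m" for m using v that by (simp add: valid_def)
    have st: "state [(1, Mass)]" "state [(w, Coord x)]" for w x
      by (auto intro: state.intros)
    have rs: "total rs \<ge> total ss"
      using pos[OF st(1)] \<Theta> by (simp add: \<Gamma> seqval_dia_seq)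
    have coeff: "seqval \<Theta> [(1, Coord x)] = 0" for x
      using pos[OF st(2)[of 1 x]] pos[OF st(2)[of "-1" x]] \<Theta>
      by (simp add: \<Gamma> seqval_dia_seq)
    have "valid {#\<Delta> + weighted rs One + weighted ss NegOne#}"
      unfolding valid_def
    proof (intro allI impI)
      fix c assume "state c"
      then have "state [(1, Child c)]" by (auto intro: state.intros)
      from pos[OF this] \<Theta>
      show "\<exists>\<Gamma>\<in>#{#\<Delta> + weighted rs One + weighted ss NegOne#}. seqval \<Gamma> c \<ge> 0"
        by (simp add: \<Gamma> seqval_dia_seq)
    qed
    then have "HMR {#dia_seq \<Delta> + weighted rs One + weighted ss NegOne#}"
      using IH rs d \<Gamma> by (intro HMR.Dia) auto
    from HMR_only_vars[OF this \<Theta> coeff] show ?thesis by (simp add: \<Gamma>)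
  qed
  {
    case 0
    have "HMR {#\<Gamma>#}" if "valid {#\<Gamma>#}" "seq_depth_le 0 \<Gamma>" "basic \<Gamma>" for \<Gamma>
      using _ that
    proof (rule *[where d=0])
      fix \<Delta> rs ss assume "seq_depth_le 0 (dia_seq \<Delta>)" "total rs \<ge> total ss"
      then show "HMR {#\<Delta> + weighted rs One + weighted ss NegOne#}"
        using HMR.One[OF _ HMR.INIT] by auto
    qed
    then show ?case using 0 complete_basic complete_reduce by metis
  next
    case (Suc d)
    have "HMR {#\<Gamma>#}" if "valid {#\<Gamma>#}" "seq_depth_le (Suc d) \<Gamma>" "basic \<Gamma>" for \<Gamma>
      using _ that by (rule *[where d="Suc d"]) (use Suc.IH in auto)
    then show ?case using Suc.prems complete_basic complete_reduce by metis
  }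
qed

theorem HMR_iff_valid: "HMR G \<longleftrightarrow> valid G"
proof
  define d where "d = Max (insert 0 ((mdepth \<circ> snd) ` set_mset (\<Sum>\<^sub># G)))"
  have "\<forall>\<Gamma>\<in>#G. seq_depth_le d \<Gamma>"
    unfolding seq_depth_le_def d_def by (auto intro!: Max_ge)
  then show "valid G \<Longrightarrow> HMR G" by (rule HMR_complete[rotated])
qed (rule HMR_sound)

section \<open>Generators of the cone of states\<close>

inductive cone :: "state list \<Rightarrow> state \<Rightarrow> bool" for p where
  Nil: "cone p []"
| gen: "g \<in> set p \<Longrightarrow> c \<ge> 0 \<Longrightarrow> cone p m \<Longrightarrow> cone p (scale c g @ m)"

lemma scale_scale [simp]: "scale c (scale d m) = scale (c * d) m"
  by (induction m) auto

lemma scale_1 [simp]: "scale 1 m = m"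
  by (induction m) auto

lemma cone_append: "cone p m \<Longrightarrow> cone p m' \<Longrightarrow> cone p (m @ m')"
  by (induction rule: cone.induct) (auto intro: cone.intros)

lemma cone_scale: "cone p m \<Longrightarrow> c \<ge> 0 \<Longrightarrow> cone p (scale c m)"
  by (induction rule: cone.induct) (auto intro: cone.intros)

lemma cone_scale_gen: "g \<in> set p \<Longrightarrow> c \<ge> 0 \<Longrightarrow> cone p (scale c g)"
  using cone.gen[OF _ _ cone.Nil] by fastforce

lemma cone_gen: "g \<in> set p \<Longrightarrow> cone p g"
  using cone_scale_gen[of g p 1] by simp

lemma cone_subset: "cone q m \<Longrightarrow> \<forall>g\<in>set q. cone p g \<Longrightarrow> cone p m"
  by (induction rule: cone.induct) (auto intro: cone.Nil cone_append cone_scale)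

lemma cone_state: "cone p m \<Longrightarrow> \<forall>g\<in>set p. state g \<Longrightarrow> state m"
  by (induction rule: cone.induct) (auto intro: state.Nil state_append state_scale)

definition linear_on :: "state list \<Rightarrow> (state \<Rightarrow> real) \<Rightarrow> bool"
  where "linear_on p h \<longleftrightarrow>
    (\<forall>c m. cone p m \<longrightarrow> c \<ge> 0 \<longrightarrow> h (scale c m) = c * h m) \<and>
    (\<forall>m m'. cone p m \<longrightarrow> cone p m' \<longrightarrow> h (m @ m') = h m + h m')"

lemma linear_on_lin [simp]: "linear_on p (lin f)"
  by (simp add: linear_on_def)

lemma linear_on_uminus: "linear_on p h \<Longrightarrow> linear_on p (\<lambda>m. - h m)"
  by (simp add: linear_on_def)

lemma linear_on_add: "linear_on p h \<Longrightarrow> linear_on p k \<Longrightarrow> linear_on p (\<lambda>m. h m + k m)"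
  by (simp add: linear_on_def algebra_simps)

lemma linear_on_mult: "linear_on p h \<Longrightarrow> linear_on p (\<lambda>m. r * h m)"
  by (simp add: linear_on_def algebra_simps)

lemma linear_on_subset: "linear_on p h \<Longrightarrow> \<forall>g\<in>set q. cone p g \<Longrightarrow> linear_on q h"
  unfolding linear_on_def using cone_subset by blast

lemma linear_on_cong: "linear_on p h \<Longrightarrow> (\<And>m. cone p m \<Longrightarrow> k m = h m) \<Longrightarrow> linear_on p k"
  by (simp add: linear_on_def cone_append cone_scale)

lemma linear_on_gen:
  assumes "linear_on p h" "g \<in> set p" "c \<ge> 0" "cone p m"
  shows "h (scale c g @ m) = c * h g + h m"
  using assms cone_gen[of g p] cone_scale_gen[of g p c] by (simp add: linear_on_def)

lemma linear_on_Nil: "linear_on p h \<Longrightarrow> h [] = 0"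
  unfolding linear_on_def using cone.Nil[of p] by (metis append_Nil add_cancel_left_left)

lemma linear_on_nonneg:
  "cone p m \<Longrightarrow> linear_on p h \<Longrightarrow> \<forall>g\<in>set p. h g \<ge> 0 \<Longrightarrow> h m \<ge> 0"
  by (induction rule: cone.induct) (auto simp: linear_on_Nil linear_on_gen)

text \<open>The coefficients are chosen before \<open>h\<close>. One choice thus serves
  \<open>val A\<close>, \<open>val B\<close> and all \<open>lin f\<close> simultaneously, as needed
  for splitting.\<close>

lemma cone_coefficients:
  assumes "cone p m"
  shows "\<exists>c. (\<forall>g. c g \<ge> 0) \<and> (\<forall>h. linear_on p h \<longrightarrow> h m = (\<Sum>g\<in>set p. c g * h g))"
  using assms
proof (induction rule: cone.induct)
  case Nil
  show ?case by (intro exI[of _ "\<lambda>g. 0"]) (auto simp: linear_on_Nil)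
next
  case (gen g c m)
  then obtain d where d: "\<And>g. d g \<ge> 0"
    "\<And>h. linear_on p h \<Longrightarrow> h m = (\<Sum>g\<in>set p. d g * h g)" by blast
  show ?case
  \<comment> \<open>The same generator may occur several times in \<open>m\<close>, so its
    coefficients are accumulated.\<close>
  proof (intro exI[of _ "d(g := c + d g)"] conjI allI impI)
    fix h assume h: "linear_on p h"
    have "(\<Sum>k\<in>set p. (d(g := c + d g)) k * h k) =
        (\<Sum>k\<in>set p. (if k = g then c * h g else 0) + d k * h k)"
      by (intro sum.cong) (auto simp: algebra_simps)
    also have "\<dots> = c * h g + h m" using gen.hyps d(2)[OF h] by (simp add: sum.distrib)
    finally show "h (scale c g @ m) = (\<Sum>k\<in>set p. (d(g := c + d g)) k * h k)"
      using linear_on_gen[OF h] gen.hyps by simp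
  qed (use gen.hyps d in auto)
qed

section \<open>Cutting a cone along the wall \<open>A = B\<close>\<close>

definition same_sum :: "state \<Rightarrow> state \<Rightarrow> bool"
  where "same_sum m m' \<longleftrightarrow> (\<forall>f. lin f m = lin f m')"

lemma same_sum_val: "same_sum m m' \<Longrightarrow> val A m = val A m'"
  by (induction A) (auto simp: same_sum_def)

lemma cone_sum:
  assumes "finite I" "\<And>i. i \<in> I \<Longrightarrow> cone p (n i)"
  shows "\<exists>m. cone p m \<and> (\<forall>f. lin f m = (\<Sum>i\<in>I. lin f (n i)))"
  using assms
proof (induction I)
  case empty
  show ?case by (intro exI[of _ "[]"]) (auto intro: cone.Nil)
next
  case (insert i I)
  then obtain m where "cone p m" "\<forall>f. lin f m = (\<Sum>i\<in>I. lin f (n i))" by auto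
  then show ?case using insert by (intro exI[of _ "n i @ m"]) (auto intro: cone_append)
qed

text \<open>If \<open>A\<close> and \<open>B\<close> are linear on the cone, they agree at this
  combination of \<open>g\<close> and \<open>h\<close>: it is a point of the wall between the two
  halves. The unnormalised weights avoid a division.\<close>

fun pairs :: "trm \<Rightarrow> trm \<Rightarrow> state \<Rightarrow> state list \<Rightarrow> state list \<Rightarrow> state list" where
  "pairs A B g [] acc = acc"
| "pairs A B g (h # q) acc = (if val A h < val B h
    then (scale (val A g - val B g) h @ scale (val B h - val A h) g) # pairs A B g q acc
    else pairs A B g q acc)"

text \<open>One step of the double description method: generators of the part of a cone where
  \<open>A \<ge> B\<close>. Both lists are the generators of the cone; only the first one is consumed.\<close>

fun split_cone :: "trm \<Rightarrow> trm \<Rightarrow> state list \<Rightarrow> state list \<Rightarrow> state list" where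
  "split_cone A B [] q = []"
| "split_cone A B (g # p) q = (if val A g < val B g then split_cone A B p q
    else g # pairs A B g q (split_cone A B p q))"

lemma set_pairs: "set (pairs A B g q acc) = set acc \<union>
    {scale (val A g - val B g) h @ scale (val B h - val A h) g | h. h \<in> set q \<and> val A h < val B h}"
  by (induction q) auto

lemma set_split_cone: "set (split_cone A B p q) = {g \<in> set p. val A g \<ge> val B g} \<union>
    {scale (val A g - val B g) h @ scale (val B h - val A h) g | g h.
      g \<in> set p \<and> val A g \<ge> val B g \<and> h \<in> set q \<and> val A h < val B h}"
  by (induction p) (auto simp: set_pairs not_less)

lemma split_cone_subset: "g \<in> set (split_cone A B p p) \<Longrightarrow> cone p g"
  by (auto simp: set_split_cone intro: cone_gen intro!: cone_append cone_scale)

lemma split_cone_ge: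
  assumes "linear_on p (val A)" "linear_on p (val B)" "cone (split_cone A B p p) m"
  shows "val A m \<ge> val B m"
proof -
  let ?h = "\<lambda>m. val A m + - val B m"
  have "linear_on p ?h" using assms by (intro linear_on_add linear_on_uminus)
  then have lin: "linear_on (split_cone A B p p) ?h"
    using split_cone_subset by (blast intro: linear_on_subset)
  have "?h (scale (val A g - val B g) h @ scale (val B h - val A h) g) = 0"
    if "g \<in> set p" "val A g \<ge> val B g" "h \<in> set p" "val A h < val B h" for g h
  proof -
    have "?h (scale (val A g - val B g) h @ scale (val B h - val A h) g) =
        (val A g - val B g) * ?h h + ?h (scale (val B h - val A h) g)"
      using \<open>linear_on p ?h\<close> that by (intro linear_on_gen) (auto intro: cone_scale_gen)
    also have "?h (scale (val B h - val A h) g) = (val B h - val A h) * ?h g"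
      using that by (simp add: algebra_simps)
    finally show ?thesis by (simp add: algebra_simps)
  qed
  then have "\<forall>g\<in>set (split_cone A B p p). ?h g \<ge> 0"
    by (force simp: set_split_cone)
  from linear_on_nonneg[OF assms(3) lin this] show ?thesis by simp
qed

text \<open>Since \<open>val A m \<ge> val B m\<close>, the surplus \<open>S\<close> of the
  generators with \<open>A \<ge> B\<close> covers the deficit \<open>V\<close> of the others. All of
  the deficit can be paired off with surplus in mixed generators, and the remaining surplus keeps
  its own generators. This yields the same formal sum, but another list.\<close>

lemma split_cone_complete:
  assumes lin: "linear_on p (val A)" "linear_on p (val B)"
    and m: "cone p m" "val A m \<ge> val B m"
  shows "\<exists>m'. cone (split_cone A B p p) m' \<and> same_sum m m'"
proof -
  let ?q = "split_cone A B p p"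
  define D where "D g = val A g - val B g" for g
  obtain c where c: "\<And>g. c g \<ge> 0"
    "\<And>h. linear_on p h \<Longrightarrow> h m = (\<Sum>g\<in>set p. c g * h g)"
    using cone_coefficients[OF m(1)] by blast
  define P where "P = {g \<in> set p. D g \<ge> 0}"
  define N where "N = {g \<in> set p. D g < 0}"
  have fin: "finite P" "finite N" and PN: "set p = P \<union> N" "P \<inter> N = {}"
    by (auto simp: P_def N_def)
  have split: "(\<Sum>g\<in>set p. k g) = (\<Sum>g\<in>P. k g) + (\<Sum>g\<in>N. k g)" for k :: "state \<Rightarrow> real"
    unfolding PN(1) using fin PN(2) by (rule sum.union_disjoint)
  define S where "S = (\<Sum>g\<in>P. c g * D g)"
  define V where "V = (\<Sum>h\<in>N. c h * (- D h))"
  have S0: "S \<ge> 0" unfolding S_def using c by (intro sum_nonneg) (auto simp: P_def)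
  have V0: "V \<ge> 0" unfolding V_def using c
    by (intro sum_nonneg mult_nonneg_nonneg) (auto simp: N_def)
  have "D m = (\<Sum>g\<in>set p. c g * D g)"
    unfolding D_def using c(2)[OF lin(1)] c(2)[OF lin(2)]
    by (simp add: algebra_simps sum_subtractf)
  moreover have "D m \<ge> 0" using m(2) by (simp add: D_def)
  moreover have "V = - (\<Sum>h\<in>N. c h * D h)" by (simp add: V_def sum_negf)
  ultimately have VS: "V \<le> S" unfolding split S_def by linarith
  \<comment> \<open>Division by zero gives \<open>0\<close>. If \<open>S = 0\<close>, then
    \<open>V = 0\<close> as well and the coefficients on \<open>N\<close> vanish, so the formulas
    below remain correct.\<close>
  have cS: "c h * (S / S) = c h" if "h \<in> N" for h
  proof (cases "S = 0")
    case True
    then have "V = 0" using VS V0 by simp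
    then have "c h * (- D h) = 0"
      unfolding V_def using that fin c
      by (subst (asm) sum_nonneg_eq_0_iff) (auto simp: N_def mult_nonneg_nonpos)
    then show ?thesis using that by (simp add: N_def)
  qed simp
  have "V / S \<le> 1" using VS S0 by (cases "S = 0") (auto simp: divide_le_eq_1)
  then have "cone ?q (scale (c g * (1 - V / S)) g)" if "g \<in> P" for g
    using that c by (intro cone_scale_gen) (auto simp: set_split_cone P_def D_def)
  from cone_sum[where n = "\<lambda>g. scale (c g * (1 - V / S)) g", OF fin(1) this] obtain m1 where m1: "cone ?q m1"
    "\<And>f. lin f m1 = (\<Sum>g\<in>P. lin f (scale (c g * (1 - V / S)) g))" by blast
  \<comment> \<open>Each \<open>g\<close> takes over every deficit in proportion to its share
    \<open>c g * D g / S\<close> of the surplus. This consumes the fraction \<open>V / S\<close> of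
    its coefficient; the rest went into \<open>m1\<close>.\<close>
  define n where "n = (\<lambda>(g, h). scale (c g * c h / S) (scale (D g) h @ scale (- D h) g))"
  have "cone ?q (n x)" if x: "x \<in> P \<times> N" for x
  proof -
    obtain g h where x': "x = (g, h)" "g \<in> P" "h \<in> N" using x by blast
    have "scale (D g) h @ scale (- D h) g \<in> set ?q"
      using x' unfolding set_split_cone P_def N_def D_def by force
    then show ?thesis using c S0 unfolding n_def x' by (auto simp del: scale_simps intro: cone_scale_gen)
  qed
  from cone_sum[where n = n, OF finite_cartesian_product[OF fin] this] obtain m2 where m2: "cone ?q m2"
    "\<And>f. lin f m2 = (\<Sum>x\<in>P \<times> N. lin f (n x))" by blast
  have prod_S: "(\<Sum>g\<in>P. \<Sum>h\<in>N. u h * (c g * D g)) = (\<Sum>h\<in>N. u h * S)" for u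
    by (subst sum.swap) (simp add: S_def sum_distrib_left)
  have prod_V: "(\<Sum>g\<in>P. \<Sum>h\<in>N. u g * (c h * (- D h))) = (\<Sum>g\<in>P. u g * V)" for u
    by (simp add: V_def sum_distrib_left)
  have "lin f m = lin f (m1 @ m2)" for f
  proof -
    have "lin f m2 = (\<Sum>g\<in>P. \<Sum>h\<in>N. (c g * c h / S) * (D g * lin f h - D h * lin f g))"
      unfolding m2(2) sum.cartesian_product by (intro sum.cong refl) (auto simp: n_def algebra_simps diff_divide_distrib)
    also have "\<dots> = (\<Sum>g\<in>P. \<Sum>h\<in>N. (c h * lin f h / S) * (c g * D g)) +
        (\<Sum>g\<in>P. \<Sum>h\<in>N. (c g * lin f g / S) * (c h * (- D h)))"
      unfolding sum.distrib[symmetric]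
      by (intro sum.cong refl) (simp add: right_diff_distrib mult.commute mult.left_commute)
    also have "(\<Sum>g\<in>P. \<Sum>h\<in>N. (c h * lin f h / S) * (c g * D g)) =
        (\<Sum>h\<in>N. (c h * lin f h / S) * S)"
      by (rule prod_S)
    also have "\<dots> = (\<Sum>h\<in>N. (c h * (S / S)) * lin f h)"
      by (intro sum.cong refl) simp
    also have "\<dots> = (\<Sum>h\<in>N. c h * lin f h)"
      using cS by (intro sum.cong refl) simp
    also have "(\<Sum>g\<in>P. \<Sum>h\<in>N. (c g * lin f g / S) * (c h * (- D h))) =
        (\<Sum>g\<in>P. (c g * lin f g / S) * V)"
      by (rule prod_V)
    finally have "lin f m1 + lin f m2 = (\<Sum>h\<in>N. c h * lin f h) +
        (\<Sum>g\<in>P. c g * (1 - V / S) * lin f g + (c g * lin f g / S) * V)"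
      unfolding m1(2) sum.distrib by simp
    also have "(\<Sum>g\<in>P. c g * (1 - V / S) * lin f g + (c g * lin f g / S) * V) =
        (\<Sum>g\<in>P. c g * lin f g)"
      by (intro sum.cong refl) (simp add: algebra_simps)
    finally show ?thesis using c(2)[OF linear_on_lin, of f] split by simp
  qed
  then show ?thesis using cone_append[OF m1(1) m2(1)] by (auto simp: same_sum_def)
qed

text \<open>Subterms below \<open>\<Diamond>\<close> are treated as well, since the generators are to become children.\<close>

primrec refine :: "trm \<Rightarrow> state list \<Rightarrow> state list list" where
  "refine (Var i) p = [p]"
| "refine (CoVar i) p = [p]"
| "refine Zero p = [p]"
| "refine One p = [p]"
| "refine NegOne p = [p]"
| "refine (Plus A B) p = concat (map (refine B) (refine A p))"
| "refine (Scale r A) p = refine A p"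
| "refine (Join A B) p = concat (map (\<lambda>q. [split_cone A B q q, split_cone B A q q])
    (concat (map (refine B) (refine A p))))"
| "refine (Meet A B) p = concat (map (\<lambda>q. [split_cone A B q q, split_cone B A q q])
    (concat (map (refine B) (refine A p))))"
| "refine (Dia A) p = refine A p"

section \<open>Linearity and covering for the pieces of a refined cone\<close>

primrec subterms :: "trm \<Rightarrow> trm set" where
  "subterms (Var i) = {Var i}"
| "subterms (CoVar i) = {CoVar i}"
| "subterms Zero = {Zero}"
| "subterms One = {One}"
| "subterms NegOne = {NegOne}"
| "subterms (Plus A B) = insert (Plus A B) (subterms A \<union> subterms B)"
| "subterms (Scale r A) = insert (Scale r A) (subterms A)"
| "subterms (Join A B) = insert (Join A B) (subterms A \<union> subterms B)"
| "subterms (Meet A B) = insert (Meet A B) (subterms A \<union> subterms B)"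
| "subterms (Dia A) = insert (Dia A) (subterms A)"

lemma subterms_refl [simp]: "A \<in> subterms A"
  by (cases A) auto

lemma subterms_trans: "A \<in> subterms B \<Longrightarrow> B \<in> subterms T \<Longrightarrow> A \<in> subterms T"
  by (induction T) auto

lemma refine_subset: "q \<in> set (refine A p) \<Longrightarrow> g \<in> set q \<Longrightarrow> cone p g"
proof (induction A arbitrary: p q g)
  case (Plus A B)
  then obtain r where "r \<in> set (refine A p)" "q \<in> set (refine B r)" by auto
  then show ?case using Plus cone_subset by metis
next
  case (Join A B)
  then obtain r s where "r \<in> set (refine A p)" "s \<in> set (refine B r)" "cone s g"
    by (auto dest: split_cone_subset)
  then show ?case using Join.IH cone_subset by metis
next
  case (Meet A B)
  then obtain r s where "r \<in> set (refine A p)" "s \<in> set (refine B r)" "cone s g"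
    by (auto dest: split_cone_subset)
  then show ?case using Meet.IH cone_subset by metis
qed (auto intro: cone_gen)

lemma linear_on_split_cone:
  assumes lin: "linear_on p (val A)" "linear_on p (val B)"
    and q: "q = split_cone A B p p \<or> q = split_cone B A p p"
  shows "linear_on q (\<lambda>m. max (val A m) (val B m))" "linear_on q (\<lambda>m. min (val A m) (val B m))"
proof -
  have "\<forall>g\<in>set q. cone p g" using q split_cone_subset by blast
  then have linear: "linear_on q (val A)" "linear_on q (val B)"
    using lin by (auto intro: linear_on_subset)
  consider "\<And>m. cone q m \<Longrightarrow> val A m \<ge> val B m" | "\<And>m. cone q m \<Longrightarrow> val B m \<ge> val A m"
    using q split_cone_ge[OF lin] split_cone_ge[OF lin(2,1)] by blast
  then have "linear_on q (\<lambda>m. max (val A m) (val B m)) \<and> linear_on q (\<lambda>m. min (val A m) (val B m))"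
  proof cases
    case 1
    then show ?thesis
      using linear_on_cong[OF linear(1)] linear_on_cong[OF linear(2)] by simp
  next
    case 2
    then show ?thesis
      using linear_on_cong[OF linear(1)] linear_on_cong[OF linear(2)] by simp
  qed
  then show "linear_on q (\<lambda>m. max (val A m) (val B m))"
    "linear_on q (\<lambda>m. min (val A m) (val B m))" by blast+
qed

text \<open>Later cuts only shrink the cone, and smaller cones inherit linearity. A
  \<open>Dia\<close> term is linear on every cone; its body is linear because \<open>refine\<close>
  cuts for it too.\<close>

lemma refine_linear: "q \<in> set (refine T p) \<Longrightarrow> A \<in> subterms T \<Longrightarrow> linear_on q (val A)"
proof (induction T arbitrary: p q A)
  case (Plus B C)
  then obtain r where r: "r \<in> set (refine B p)" "q \<in> set (refine C r)" by auto
  have B: "linear_on q (val D)" if "D \<in> subterms B" for D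
    using Plus.IH(1)[OF r(1) that] r(2) by (blast intro: linear_on_subset refine_subset)
  have C: "linear_on q (val D)" if "D \<in> subterms C" for D
    using Plus.IH(2)[OF r(2) that] .
  show ?case using Plus.prems(2) B C linear_on_add[OF B[OF subterms_refl] C[OF subterms_refl]]
    by auto
next
  case (Scale r T)
  then show ?case by (auto intro!: linear_on_mult)
next
  case (Join B C)
  then obtain r s where r: "r \<in> set (refine B p)" "s \<in> set (refine C r)"
    and q: "q = split_cone B C s s \<or> q = split_cone C B s s" by auto
  have sub: "\<forall>g\<in>set q. cone s g" using q split_cone_subset by blast
  have B: "linear_on s (val D)" if "D \<in> subterms B" for D
    using Join.IH(1)[OF r(1) that] r(2) by (blast intro: linear_on_subset refine_subset)
  have C: "linear_on s (val D)" if "D \<in> subterms C" for D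
    using Join.IH(2)[OF r(2) that] .
  show ?case using Join.prems(2) B C linear_on_split_cone(1)[OF B[OF subterms_refl] C[OF subterms_refl] q]
    by (auto intro: linear_on_subset[OF _ sub])
next
  case (Meet B C)
  then obtain r s where r: "r \<in> set (refine B p)" "s \<in> set (refine C r)"
    and q: "q = split_cone B C s s \<or> q = split_cone C B s s" by auto
  have sub: "\<forall>g\<in>set q. cone s g" using q split_cone_subset by blast
  have B: "linear_on s (val D)" if "D \<in> subterms B" for D
    using Meet.IH(1)[OF r(1) that] r(2) by (blast intro: linear_on_subset refine_subset)
  have C: "linear_on s (val D)" if "D \<in> subterms C" for D
    using Meet.IH(2)[OF r(2) that] .
  show ?case using Meet.prems(2) B C linear_on_split_cone(2)[OF B[OF subterms_refl] C[OF subterms_refl] q]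
    by (auto intro: linear_on_subset[OF _ sub])
qed (auto simp: linear_on_uminus, simp add: linear_on_def)

text \<open>At each cut the comparison of \<open>val A\<close> and \<open>val B\<close> tells which
  half to enter. Values are insensitive to the change of list by
  \<open>same_sum_val\<close>.\<close>

lemma refine_complete:
  "cone p m \<Longrightarrow> \<exists>q\<in>set (refine T p). \<exists>m'. cone q m' \<and> same_sum m m'"
proof (induction T arbitrary: p m)
  case (Plus A B)
  then obtain q m' where q: "q \<in> set (refine A p)" "cone q m'" "same_sum m m'" by blast
  then obtain r m'' where "r \<in> set (refine B q)" "cone r m''" "same_sum m' m''"
    using Plus.IH(2) by blast
  then show ?case using q by (auto simp: same_sum_def)
next
  case (Join A B)
  then obtain q m' where q: "q \<in> set (refine A p)" "cone q m'" "same_sum m m'" by blast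
  then obtain r m'' where r: "r \<in> set (refine B q)" "cone r m''" "same_sum m' m''"
    using Join.IH(2) by blast
  have lin: "linear_on r (val A)" "linear_on r (val B)"
    using refine_subset[OF r(1)] refine_linear[OF r(1) subterms_refl]
      linear_on_subset[OF refine_linear[OF q(1) subterms_refl], of r] by blast+
  obtain s n where "s = split_cone A B r r \<or> s = split_cone B A r r" "cone s n" "same_sum m'' n"
    using split_cone_complete[OF lin r(2)] split_cone_complete[OF lin(2,1) r(2)]
    using linear[of "val B m''" "val A m''"] by blast
  then show ?case using q r by (fastforce simp: same_sum_def)
next
  case (Meet A B)
  then obtain q m' where q: "q \<in> set (refine A p)" "cone q m'" "same_sum m m'" by blast
  then obtain r m'' where r: "r \<in> set (refine B q)" "cone r m''" "same_sum m' m''"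
    using Meet.IH(2) by blast
  have lin: "linear_on r (val A)" "linear_on r (val B)"
    using refine_subset[OF r(1)] refine_linear[OF r(1) subterms_refl]
      linear_on_subset[OF refine_linear[OF q(1) subterms_refl], of r] by blast+
  obtain s n where "s = split_cone A B r r \<or> s = split_cone B A r r" "cone s n" "same_sum m'' n"
    using split_cone_complete[OF lin r(2)] split_cone_complete[OF lin(2,1) r(2)]
    using linear[of "val B m''" "val A m''"] by blast
  then show ?case using q r by (fastforce simp: same_sum_def)
qed (auto simp: same_sum_def)

section \<open>Generators for each modal depth\<close>

primrec coords :: "trm \<Rightarrow> state list" where
  "coords (Var i) = [[(1, Coord i)], [(-1, Coord i)]]"
| "coords (CoVar i) = [[(1, Coord i)], [(-1, Coord i)]]"
| "coords Zero = []"
| "coords One = []"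
| "coords NegOne = []"
| "coords (Plus A B) = coords A @ coords B"
| "coords (Scale r A) = coords A"
| "coords (Join A B) = coords A @ coords B"
| "coords (Meet A B) = coords A @ coords B"
| "coords (Dia A) = coords A"

text \<open>After \<open>d\<close> steps from \<open>base T\<close>, the generators suffice for the subterms of \<open>T\<close> of modal
  depth at most \<open>d\<close>. Walking through \<open>T\<close>, \<open>levels\<close> makes at least as many steps as the modal depth
  of \<open>T\<close>; superfluous steps do no harm.\<close>

definition base :: "trm \<Rightarrow> state list"
  where "base T = [(1, Mass)] # coords T"

definition step :: "trm \<Rightarrow> state list \<Rightarrow> state list"
  where "step T p = map (\<lambda>g. [(1, Child g)]) (concat (refine T p)) @ base T"

primrec levels :: "trm \<Rightarrow> trm \<Rightarrow> state list \<Rightarrow> state list" where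
  "levels T (Var i) p = p"
| "levels T (CoVar i) p = p"
| "levels T Zero p = p"
| "levels T One p = p"
| "levels T NegOne p = p"
| "levels T (Plus A B) p = levels T B (levels T A p)"
| "levels T (Scale r A) p = levels T A p"
| "levels T (Join A B) p = levels T B (levels T A p)"
| "levels T (Meet A B) p = levels T B (levels T A p)"
| "levels T (Dia A) p = step T (levels T A p)"

definition generators :: "trm \<Rightarrow> state list"
  where "generators T = concat (refine T (levels T T (base T)))"

lemma levels_iterate: "\<exists>d\<ge>mdepth A. \<forall>p. levels T A p = (step T ^^ d) p"
proof (induction A)
  case (Plus A B)
  then obtain d e where "d \<ge> mdepth A" "\<forall>p. levels T A p = (step T ^^ d) p"
    "e \<ge> mdepth B" "\<forall>p. levels T B p = (step T ^^ e) p" by blast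
  then show ?case by (intro exI[of _ "e + d"]) (auto simp: funpow_add)
next
  case (Join A B)
  then obtain d e where "d \<ge> mdepth A" "\<forall>p. levels T A p = (step T ^^ d) p"
    "e \<ge> mdepth B" "\<forall>p. levels T B p = (step T ^^ e) p" by blast
  then show ?case by (intro exI[of _ "e + d"]) (auto simp: funpow_add)
next
  case (Meet A B)
  then obtain d e where "d \<ge> mdepth A" "\<forall>p. levels T A p = (step T ^^ d) p"
    "e \<ge> mdepth B" "\<forall>p. levels T B p = (step T ^^ e) p" by blast
  then show ?case by (intro exI[of _ "e + d"]) (auto simp: funpow_add)
next
  case (Dia A)
  then obtain d where "d \<ge> mdepth A" "\<forall>p. levels T A p = (step T ^^ d) p" by blast
  then show ?case by (intro exI[of _ "Suc d"]) auto
qed (auto intro: exI[of _ 0])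

lemma state_coords: "g \<in> set (coords T) \<Longrightarrow> state g"
  by (induction T) (auto intro: state.intros)

lemma state_base: "g \<in> set (base T) \<Longrightarrow> state g"
  by (auto simp: base_def state_coords intro: state.intros)

lemma state_refine: "\<forall>g\<in>set p. state g \<Longrightarrow> g \<in> set (concat (refine T p)) \<Longrightarrow> state g"
  using refine_subset cone_state by fastforce

lemma state_step: "\<forall>g\<in>set p. state g \<Longrightarrow> g \<in> set (step T p) \<Longrightarrow> state g"
  using state_refine[of p] state_base by (auto simp: step_def intro!: state.intros)

lemma state_iterate: "g \<in> set ((step T ^^ d) (base T)) \<Longrightarrow> state g"
proof (induction d arbitrary: g)
  case (Suc d)
  then show ?case using state_step[of "(step T ^^ d) (base T)"] by simp
qed (simp add: state_base)

text \<open>Coefficients in a cone are nonnegative, so a coordinate of arbitrary sign needs both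
  unit vectors.\<close>

lemma coords_subterms:
  "Var i \<in> subterms T \<or> CoVar i \<in> subterms T \<Longrightarrow>
    {[(1, Coord i)], [(-1, Coord i)]} \<subseteq> set (coords T)"
  by (induction T) auto

text \<open>The reason why generators may become children: the coefficients of \<open>c\<close> over
  \<open>q\<close> turn into weights of children. A function on children that is linear on
  \<open>q\<close> cannot tell these children from the single child \<open>c\<close>.\<close>

lemma cone_children:
  assumes "cone q c"
  shows "\<exists>n. cone (map (\<lambda>g. [(1, Child g)]) q) n \<and>
    (\<forall>f. linear_on q (\<lambda>c. f (Child c)) \<longrightarrow> lin f n = f (Child c))"
  using assms
proof (induction rule: cone.induct)
  case Nil
  show ?case by (intro exI[of _ "[]"]) (auto intro: cone.Nil dest: linear_on_Nil)
next
  case (gen g w c)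
  then obtain n where n: "cone (map (\<lambda>g. [(1, Child g)]) q) n"
    "\<And>f. linear_on q (\<lambda>c. f (Child c)) \<Longrightarrow> lin f n = f (Child c)" by blast
  show ?case
  proof (intro exI[of _ "scale w [(1, Child g)] @ n"] conjI allI impI)
    show "cone (map (\<lambda>g. [(1, Child g)]) q) (scale w [(1, Child g)] @ n)"
      using gen.hyps n by (intro cone.gen) auto
    fix f :: "atom \<Rightarrow> real" assume f: "linear_on q (\<lambda>c. f (Child c))"
    show "lin f (scale w [(1, Child g)] @ n) = f (Child (scale w g @ c))"
      using linear_on_gen[OF f gen.hyps] n(2)[OF f] by simp
  qed
qed

text \<open>The clause is restricted to \<open>outer A = 0\<close> because such terms are additive,
  which makes the relation compatible with concatenation; \<open>agree_val\<close> recovers the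
  other terms. The mass is listed separately, as \<open>One\<close> need not be a subterm of
  \<open>T\<close>.\<close>

definition agree :: "trm \<Rightarrow> nat \<Rightarrow> state \<Rightarrow> state \<Rightarrow> bool"
  where "agree T d m m' \<longleftrightarrow> lin mass m = lin mass m' \<and>
    (\<forall>A\<in>subterms T. outer A = 0 \<longrightarrow> mdepth A \<le> d \<longrightarrow> val A m = val A m')"

lemma agree_val:
  "agree T d m m' \<Longrightarrow> A \<in> subterms T \<Longrightarrow> mdepth A \<le> d \<Longrightarrow> val A m = val A m'"
proof (induction A)
  case (Plus A B)
  then show ?case using subterms_trans[of _ "Plus A B" T] by simp
next
  case (Scale r A)
  then show ?case using subterms_trans[of _ "Scale r A" T] by simp
next
  case (Join A B)
  then show ?case using subterms_trans[of _ "Join A B" T] by simp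
next
  case (Meet A B)
  then show ?case using subterms_trans[of _ "Meet A B" T] by simp
qed (auto simp: agree_def)

lemma agree_append: "agree T d m m' \<Longrightarrow> agree T d n n' \<Longrightarrow> agree T d (m @ n) (m' @ n')"
  by (simp add: agree_def val_append_outer_0)

lemma agree_refl [simp]: "agree T d m m"
  by (simp add: agree_def)

lemma iterate_complete:
  "state m \<Longrightarrow> \<exists>m'. cone ((step T ^^ d) (base T)) m' \<and> agree T d m m'"
proof (induction d arbitrary: m)
  have *: "\<exists>m'. cone p m' \<and> agree T d m m'"
    if "state m" and base: "set (base T) \<subseteq> set p" and
    child: "\<And>w c. state c \<Longrightarrow> w \<ge> 0 \<Longrightarrow> \<exists>m'. cone p m' \<and> agree T d [(w, Child c)] m'" for p d m
    using that(1)
  proof (induction rule: state.induct)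
    case Nil
    show ?case by (intro exI[of _ "[]"]) (auto intro: cone.Nil)
  next
    case (Mass m w)
    then obtain m' where "cone p m'" "agree T d m m'" by blast
    moreover have "[(1, Mass)] \<in> set p" using base by (auto simp: base_def)
    ultimately have "cone p (scale w [(1, Mass)] @ m')" "agree T d (scale w [(1, Mass)] @ m) (scale w [(1, Mass)] @ m')"
      using Mass by (blast intro: cone.gen agree_append agree_refl)+
    then show ?case by auto
  next
    case (Coord m w i)
    then obtain m' where m': "cone p m'" "agree T d m m'" by blast
    show ?case
    proof (cases "Var i \<in> subterms T \<or> CoVar i \<in> subterms T")
      case True
      then have "[(1, Coord i)] \<in> set p" "[(-1, Coord i)] \<in> set p"
        using base coords_subterms by (fastforce simp: base_def)+
      then have "cone p ([(w, Coord i)] @ m')"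
        using m'(1) cone.gen[of "[(1, Coord i)]" p w m'] cone.gen[of "[(-1, Coord i)]" p "- w" m']
        by (cases "w \<ge> 0") auto
      moreover have "agree T d ([(w, Coord i)] @ m) ([(w, Coord i)] @ m')"
        using m' by (intro agree_append) auto
      ultimately show ?thesis by auto
    next
      case False
      have "val A [(w, Coord i)] = val A []" if "A \<in> subterms T" "outer A = 0" for A
        using that False by (cases A) auto
      then have "agree T d [(w, Coord i)] []"
        by (auto simp: agree_def)
      from agree_append[OF this m'(2)] m'(1) show ?thesis by auto
    qed
  next
    case (Child m c w)
    then obtain m' n where "cone p m'" "agree T d m m'" "cone p n" "agree T d [(w, Child c)] n"
      using child by blast
    then show ?case using agree_append[of T d "[(w, Child c)]" n m m'] cone_append by force
  qed
  {
    case 0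
    have "\<exists>m'. cone (base T) m' \<and> agree T 0 [(w, Child c)] m'" if "state c" "w \<ge> 0" for w c
    proof (intro exI conjI)
      \<comment> \<open>At depth 0 only the mass of a child is visible, so plain mass of the same
        amount replaces it.\<close>
      show "cone (base T) (scale (w * lin mass c) [(1, Mass)])"
        using that lin_mass_nonneg by (intro cone_scale_gen) (auto simp: base_def)
      have "val A [(w, Child c)] = val A (scale (w * lin mass c) [(1, Mass)])"
        if "outer A = 0" "mdepth A = 0" for A
        using that by (cases A) auto
      then show "agree T 0 [(w, Child c)] (scale (w * lin mass c) [(1, Mass)])"
        by (auto simp: agree_def)
    qed
    then show ?case using *[OF 0] by auto
  next
    case (Suc d)
    let ?p = "(step T ^^ d) (base T)"
    have "\<exists>m'. cone (step T ?p) m' \<and> agree T (Suc d) [(w, Child c)] m'"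
      if c: "state c" and w: "w \<ge> 0" for w c
    proof -
      \<comment> \<open>The child is replaced three times: by an element of the cone for depth
        \<open>d\<close>, then by the same sum inside a piece \<open>q\<close> where all subterms
        are linear, and finally by generators of \<open>q\<close> as children.\<close>
      obtain c' where c': "cone ?p c'" "agree T d c c'" using Suc.IH[OF c] by blast
      obtain q c'' where q: "q \<in> set (refine T ?p)" "cone q c''" "same_sum c' c''"
        using refine_complete[OF c'(1)] by blast
      obtain n where n: "cone (map (\<lambda>g. [(1, Child g)]) q) n"
        "\<And>f. linear_on q (\<lambda>c. f (Child c)) \<Longrightarrow> lin f n = f (Child c'')"
        using cone_children[OF q(2)] by blast
      have "cone (step T ?p) n"
        using q(1) by (intro cone_subset[OF n(1)]) (force simp: step_def intro: cone_gen)
      then have "cone (step T ?p) (scale w n)" using w by (rule cone_scale)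
      moreover have mass: "lin mass n = lin mass c"
        using c'(2) q(3) n(2)[of mass] by (simp add: agree_def same_sum_def)
      have "val A [(w, Child c)] = val A (scale w n)"
        if A: "A \<in> subterms T" "outer A = 0" "mdepth A \<le> Suc d" for A
      proof (cases A)
        case (Dia B)
        then have B: "B \<in> subterms T" using A(1) subterms_trans[of B A T] by simp
        have "val B c = val B c''"
          using agree_val[OF c'(2) B] same_sum_val[OF q(3)] A(3) Dia by simp
        moreover have "linear_on q (val B)" using refine_linear[OF q(1) B] .
        ultimately show ?thesis
          unfolding Dia using n(2)[of "\<lambda>a. case a of Child c \<Rightarrow> val B c | _ \<Rightarrow> 0"]
          by simp
      next
        case (Var i)
        then show ?thesis
          using n(2)[of "\<lambda>a. if a = Coord i then 1 else 0"] by (simp add: linear_on_def)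
      next
        case (CoVar i)
        then show ?thesis
          using n(2)[of "\<lambda>a. if a = Coord i then 1 else 0"] by (simp add: linear_on_def)
      qed (use A mass in auto)
      then have "agree T (Suc d) [(w, Child c)] (scale w n)"
        using mass by (simp add: agree_def)
      ultimately show ?thesis by blast
    qed
    moreover have "set (base T) \<subseteq> set (step T ?p)" by (simp add: step_def)
    ultimately show ?case using *[OF Suc.prems, of "step T ?p" "Suc d"] by simp
  }
qed

text \<open>The last refinement in \<open>generators\<close> matters here: nonnegativity on
  generators extends to a cone only where \<open>val T\<close> is linear.\<close>

theorem generators_decide:
  "(\<forall>g\<in>set (generators T). val T g \<ge> 0) \<longleftrightarrow> (\<forall>m. state m \<longrightarrow> val T m \<ge> 0)"
proof -
  obtain d where d: "d \<ge> mdepth T" "levels T T (base T) = (step T ^^ d) (base T)"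
    using levels_iterate[of T T] by blast
  have "state g" if "g \<in> set (generators T)" for g
    using that state_iterate state_refine unfolding generators_def d(2) by blast
  moreover have "val T m \<ge> 0"
    if gens: "\<forall>g\<in>set (generators T). val T g \<ge> 0" and m: "state m" for m
  proof -
    obtain m' where m': "cone ((step T ^^ d) (base T)) m'" "agree T d m m'"
      using iterate_complete[OF m] by blast
    then obtain q m'' where q: "q \<in> set (refine T (levels T T (base T)))"
      "cone q m''" "same_sum m' m''"
      using refine_complete d(2) by metis
    have "val T m'' \<ge> 0"
      using linear_on_nonneg[OF q(2) refine_linear[OF q(1)]] gens q(1)
      by (auto simp: generators_def)
    then show ?thesis using agree_val[OF m'(2)] same_sum_val[OF q(3)] d(1) by simp
  qed
  ultimately show ?thesis by blast
qed

section \<open>From a hypersequent to one term\<close>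

primrec sum_term :: "(posreal \<times> trm) list \<Rightarrow> trm" where
  "sum_term [] = Zero"
| "sum_term (p # \<Gamma>) = Plus (Scale (fst p) (snd p)) (sum_term \<Gamma>)"

text \<open>No term is a least element that could start the joins, so the accumulator begins with
  the first sequent of a nonempty hypersequent.\<close>

primrec join_term :: "hyperlist \<Rightarrow> trm \<Rightarrow> trm" where
  "join_term [] A = A"
| "join_term (\<Gamma> # H) A = join_term H (Join A (sum_term \<Gamma>))"

lemma val_sum_term: "val (sum_term \<Gamma>) m = seqval (mset \<Gamma>) m"
  by (induction \<Gamma>) (auto simp: split_paired_all)

lemma val_join_term:
  "val (join_term H A) m \<ge> 0 \<longleftrightarrow> val A m \<ge> 0 \<or> (\<exists>\<Gamma>\<in>set H. seqval (mset \<Gamma>) m \<ge> 0)"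
  by (induction H arbitrary: A) (auto simp: val_sum_term le_max_iff_disj)

theorem HMR_iff_generators:
  "HMR (hyperseq_of (\<Gamma> # H)) \<longleftrightarrow>
    (\<forall>g\<in>set (generators (join_term H (sum_term \<Gamma>))). val (join_term H (sum_term \<Gamma>)) g \<ge> 0)"
  unfolding generators_decide HMR_iff_valid valid_def
  by (auto simp: val_join_term val_sum_term hyperseq_of_def)

section \<open>The program\<close>

text \<open>As a partial function, evaluation can be carried out by rewriting; \<open>None\<close>
  covers divergence as well as indices out of range.\<close>

definition run :: "program \<Rightarrow> data list \<Rightarrow> expr \<Rightarrow> data option"
  where "run P env e = (if \<exists>v. eval P env e v then Some (THE v. eval P env e v) else None)"

lemma run_eq_Some: "run P env e = Some v \<longleftrightarrow> eval P env e v"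
proof -
  have "(THE v. eval P env e v) = v" if "eval P env e v" for v
    using that eval_deterministic by (intro the_equality) blast+
  then show ?thesis unfolding run_def by auto
qed

lemma option_eqI: "(\<And>v. x = Some v \<longleftrightarrow> y = Some v) \<Longrightarrow> x = y"
  by (metis not_Some_eq)

lemma those_eq_Some: "those xs = Some ys \<longleftrightarrow> list_all2 (\<lambda>x y. x = Some y) xs ys"
proof (induction xs arbitrary: ys)
  case (Cons x xs)
  show ?case by (cases x; cases ys) (auto simp: Cons)
qed auto

lemma run_simps [simp]:
  "run P env (Arg i) = (if i < length env then Some (env ! i) else None)"
  "run P env NullE = Some Null"
  "run P env OneE = Some (Num 1)"
  "run P env (Unary f e) = map_option (apply_unop f) (run P env e)"
  "run P env (Binary g e1 e2) =
    Option.bind (run P env e1) (\<lambda>v1. map_option (apply_binop g v1) (run P env e2))"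
  "run P env (If e e1 e2) =
    Option.bind (run P env e) (\<lambda>u. if u = Null then run P env e2 else run P env e1)"
  by (rule option_eqI;
      force simp: run_eq_Some bind_eq_Some_conv intro: eval.intros elim: eval_elims split: if_splits)+

lemma run_Call: "run P env (Call f es) =
  (if f < length P then Option.bind (those (map (run P env) es)) (\<lambda>vs. run P vs (P ! f)) else None)"
  by (rule option_eqI)
    (auto simp: run_eq_Some bind_eq_Some_conv those_eq_Some list_all2_map1
      intro: eval.intros elim!: eval_elims)

lemma truth_eq_Null [simp]: "truth b = Null \<longleftrightarrow> \<not> b"
  by (simp add: truth_def)

primrec num_expr :: "nat \<Rightarrow> expr" where
  "num_expr 0 = Binary Sub OneE OneE"
| "num_expr (Suc n) = Binary Add OneE (num_expr n)"

lemma run_num_expr [simp]: "run P env (num_expr n) = Some (enc_nat n)"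
  by (induction n) (auto simp: enc_nat_def)

lemma enc_nat_simps [simp]:
  "enc_nat n \<noteq> Null"
  "apply_binop Less (enc_nat n) (enc_nat m) = truth (n < m)"
  "apply_unop IsNum (enc_nat n) = truth True"
  "apply_unop IsPair (enc_nat n) = Null"
  by (simp_all add: enc_nat_def)

text \<open>Tags are compared by \<open>Less\<close> only: once the smaller tags are excluded, tag
  \<open>n\<close> is recognised by being less than \<open>Suc n\<close>. The last branch needs no
  test.\<close>

fun case_from :: "nat \<Rightarrow> expr list \<Rightarrow> expr" where
  "case_from n [] = NullE"
| "case_from n [e] = e"
| "case_from n (e # es) =
    If (Binary Less (Unary Fst (Arg 0)) (num_expr (Suc n))) e (case_from (Suc n) es)"

text \<open>Dispatch on the constructor of the term that is the first argument.\<close>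

abbreviation trm_case :: "expr list \<Rightarrow> expr"
  where "trm_case es \<equiv> case_from 0 es"

lemma run_case_from:
  "k < length es \<Longrightarrow> run P (Pair (enc_nat (n + k)) d # vs) (case_from n es) =
    run P (Pair (enc_nat (n + k)) d # vs) (es ! k)"
proof (induction n es arbitrary: k rule: case_from.induct)
  case (3 n e e' es)
  show ?case
  proof (cases k)
    case (Suc j)
    then show ?thesis using 3(1)[of j] 3(2) by (simp del: case_from.simps(2) num_expr.simps)
  qed (simp del: num_expr.simps)
qed auto

lemma run_trm_case [simp]:
  "k < length es \<Longrightarrow> run P (Pair (enc_nat k) d # vs) (trm_case es) =
    run P (Pair (enc_nat k) d # vs) (es ! k)"
  using run_case_from[of k es P 0] by simp

declare case_from.simps [simp del] num_expr.simps [simp del]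

text \<open>The three kinds of atoms are told apart by \<open>IsNum\<close> and
  \<open>IsPair\<close>. Without the extra \<open>Pair\<close>, a child with the empty list would be
  encoded like \<open>Mass\<close>.\<close>

fun enc_atom :: "atom \<Rightarrow> data" where
  "enc_atom Mass = Null"
| "enc_atom (Coord i) = enc_nat i"
| "enc_atom (Child m) = Pair Null (enc_list (map (\<lambda>(w, a). Pair (Num w) (enc_atom a)) m))"

definition enc_state :: "state \<Rightarrow> data"
  where "enc_state m = enc_list (map (\<lambda>(w, a). Pair (Num w) (enc_atom a)) m)"

lemma enc_state_simps [simp]:
  "enc_state [] = Null"
  "enc_state ((w, a) # m) = Pair (Pair (Num w) (enc_atom a)) (enc_state m)"
  by (simp_all add: enc_state_def)

lemma enc_atom_Child: "enc_atom (Child m) = Pair Null (enc_state m)"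
  by (simp add: enc_state_def)

declare enc_atom.simps(3) [simp del] enc_atom_Child [simp]

definition enc_cone :: "state list \<Rightarrow> data"
  where "enc_cone p = enc_list (map enc_state p)"

lemma enc_cone_simps [simp]:
  "enc_cone [] = Null"
  "enc_cone (g # p) = Pair (enc_state g) (enc_cone p)"
  by (simp_all add: enc_cone_def)

definition enc_cones :: "state list list \<Rightarrow> data"
  where "enc_cones ps = enc_list (map enc_cone ps)"

lemma enc_cones_simps [simp]:
  "enc_cones [] = Null"
  "enc_cones (p # ps) = Pair (enc_cone p) (enc_cones ps)"
  by (simp_all add: enc_cones_def)

section \<open>The functions of the program\<close>

abbreviation "hd_expr e \<equiv> Unary Fst e"
abbreviation "tl_expr e \<equiv> Unary Snd e"
abbreviation "cons_expr e e' \<equiv> Binary Cons e e'"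
abbreviation "zero_expr \<equiv> Binary Sub OneE OneE"
abbreviation "neg_expr e \<equiv> Binary Sub zero_expr e"
abbreviation "body_expr \<equiv> Unary Snd (Arg 0)"
abbreviation "left_expr \<equiv> Unary Fst body_expr"
abbreviation "right_expr \<equiv> Unary Snd body_expr"

abbreviation "decide_call T \<equiv> Call 1 [T]"
abbreviation "append_call x y \<equiv> Call 2 [x, y]"
abbreviation "concat_call x \<equiv> Call 3 [x]"
abbreviation "scale_call c m \<equiv> Call 4 [c, m]"
abbreviation "atom_call A a \<equiv> Call 5 [A, a]"
abbreviation "lin_call A m \<equiv> Call 6 [A, m]"
abbreviation "val_call A m \<equiv> Call 7 [A, m]"
abbreviation "pairs_call A B g q acc \<equiv> Call 8 [A, B, g, q, acc]"
abbreviation "split_call A B p q \<equiv> Call 9 [A, B, p, q]"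
abbreviation "splits_call A B ps \<equiv> Call 10 [A, B, ps]"
abbreviation "refines_call A ps \<equiv> Call 11 [A, ps]"
abbreviation "refine_call A p \<equiv> Call 12 [A, p]"
abbreviation "coords_call A \<equiv> Call 13 [A]"
abbreviation "base_call T \<equiv> Call 14 [T]"
abbreviation "children_call p \<equiv> Call 15 [p]"
abbreviation "step_call T p \<equiv> Call 16 [T, p]"
abbreviation "levels_call A T p \<equiv> Call 17 [A, T, p]"
abbreviation "nonneg_call T p \<equiv> Call 18 [T, p]"
abbreviation "sum_call s \<equiv> Call 19 [s]"
abbreviation "join_call H A \<equiv> Call 20 [H, A]"

definition "main_body = decide_call (join_call (tl_expr (Arg 0)) (sum_call (hd_expr (Arg 0))))"

definition "decide_body = nonneg_call (Arg 0)
  (concat_call (refine_call (Arg 0) (levels_call (Arg 0) (Arg 0) (base_call (Arg 0)))))"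

definition "append_body = If (Arg 0)
  (cons_expr (hd_expr (Arg 0)) (append_call (tl_expr (Arg 0)) (Arg 1))) (Arg 1)"

definition "concat_body = If (Arg 0)
  (append_call (hd_expr (Arg 0)) (concat_call (tl_expr (Arg 0)))) NullE"

definition "scale_body = If (Arg 1)
  (cons_expr (cons_expr (Binary Mul (Arg 0) (hd_expr (hd_expr (Arg 1)))) (tl_expr (hd_expr (Arg 1))))
    (scale_call (Arg 0) (tl_expr (Arg 1)))) NullE"

definition "coord_test_expr = If (Unary IsNum (Arg 1))
  (If (Binary Less (Arg 1) body_expr) zero_expr (If (Binary Less body_expr (Arg 1)) zero_expr OneE))
  zero_expr"

text \<open>For \<open>NegOne\<close> this is the mass as well; the sign is applied once, in
  \<open>val_body\<close>.\<close>

definition "mass_expr = If (Unary IsPair (Arg 1)) (lin_call (Arg 0) (tl_expr (Arg 1)))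
  (If (Unary IsNum (Arg 1)) zero_expr OneE)"

definition "child_expr = If (Unary IsPair (Arg 1)) (val_call body_expr (tl_expr (Arg 1))) zero_expr"

definition "atom_body = trm_case [coord_test_expr, coord_test_expr, NullE, mass_expr, mass_expr,
  NullE, NullE, NullE, NullE, child_expr]"

definition "lin_body = If (Arg 1)
  (Binary Add
    (Binary Mul (hd_expr (hd_expr (Arg 1))) (atom_call (Arg 0) (tl_expr (hd_expr (Arg 1)))))
    (lin_call (Arg 0) (tl_expr (Arg 1)))) zero_expr"

text \<open>For \<open>Scale\<close> the left component of the body is the scalar itself. Only the
  selected branch is evaluated, so recursive calls that make no sense for an atomic term are never
  reached.\<close>

definition "val_body = (
  let lin = lin_call (Arg 0) (Arg 1); l = val_call left_expr (Arg 1); r = val_call right_expr (Arg 1)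
  in trm_case [lin, neg_expr lin, zero_expr, lin, neg_expr lin,
    Binary Add l r, Binary Mul left_expr r, If (Binary Less l r) r l, If (Binary Less l r) l r, lin])"

definition "pairs_body = (
  let dg = Binary Sub (val_call (Arg 0) (Arg 2)) (val_call (Arg 1) (Arg 2));
    h = hd_expr (Arg 3);
    dh = Binary Sub (val_call (Arg 1) h) (val_call (Arg 0) h);
    rec = pairs_call (Arg 0) (Arg 1) (Arg 2) (tl_expr (Arg 3)) (Arg 4)
  in If (Arg 3) (If (Binary Less (val_call (Arg 0) h) (val_call (Arg 1) h))
    (cons_expr (append_call (scale_call dg h) (scale_call dh (Arg 2))) rec) rec) (Arg 4))"

definition "split_body = (
  let g = hd_expr (Arg 2); rec = split_call (Arg 0) (Arg 1) (tl_expr (Arg 2)) (Arg 3)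
  in If (Arg 2) (If (Binary Less (val_call (Arg 0) g) (val_call (Arg 1) g)) rec
    (cons_expr g (pairs_call (Arg 0) (Arg 1) g (Arg 3) rec))) NullE)"

definition "splits_body = (
  let q = hd_expr (Arg 2)
  in If (Arg 2) (cons_expr (split_call (Arg 0) (Arg 1) q q) (cons_expr (split_call (Arg 1) (Arg 0) q q)
    (splits_call (Arg 0) (Arg 1) (tl_expr (Arg 2))))) NullE)"

definition "refines_body = If (Arg 1)
  (append_call (refine_call (Arg 0) (hd_expr (Arg 1))) (refines_call (Arg 0) (tl_expr (Arg 1)))) NullE"

definition "refine_body = (
  let single = cons_expr (Arg 1) NullE;
    both = refines_call right_expr (refine_call left_expr (Arg 1));
    cut = splits_call left_expr right_expr both
  in trm_case [single, single, single, single, single,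
    both, refine_call right_expr (Arg 1), cut, cut, refine_call body_expr (Arg 1)])"

definition "coords_body = (
  let coord = (\<lambda>c. cons_expr (cons_expr c body_expr) NullE);
    both = append_call (coords_call left_expr) (coords_call right_expr);
    var = cons_expr (coord OneE) (cons_expr (coord (neg_expr OneE)) NullE)
  in trm_case [var, var, NullE, NullE, NullE, both, coords_call right_expr, both, both,
    coords_call body_expr])"

definition "base_body = cons_expr (cons_expr (cons_expr OneE NullE) NullE) (coords_call (Arg 0))"

definition "children_body = If (Arg 0)
  (cons_expr (cons_expr (cons_expr OneE (cons_expr NullE (hd_expr (Arg 0)))) NullE)
    (children_call (tl_expr (Arg 0)))) NullE"

definition "step_body = append_call (children_call (concat_call (refine_call (Arg 0) (Arg 1))))
  (base_call (Arg 0))"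

definition "levels_body = (
  let both = levels_call right_expr (Arg 1) (levels_call left_expr (Arg 1) (Arg 2))
  in trm_case [Arg 2, Arg 2, Arg 2, Arg 2, Arg 2, both, levels_call right_expr (Arg 1) (Arg 2),
    both, both, step_call (Arg 1) (levels_call body_expr (Arg 1) (Arg 2))])"

definition "nonneg_body = If (Arg 1)
  (If (Binary Less (val_call (Arg 0) (hd_expr (Arg 1))) zero_expr) NullE
    (nonneg_call (Arg 0) (tl_expr (Arg 1)))) OneE"

text \<open>An encoded weighted term is already the payload of \<open>Scale\<close>, so it only
  receives the tag 6.\<close>

definition "sum_body = If (Arg 0)
  (cons_expr (num_expr 5) (cons_expr (cons_expr (num_expr 6) (hd_expr (Arg 0)))
    (sum_call (tl_expr (Arg 0)))))
  (cons_expr (num_expr 2) NullE)"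

definition "join_body = If (Arg 0)
  (join_call (tl_expr (Arg 0))
    (cons_expr (num_expr 7) (cons_expr (Arg 1) (sum_call (hd_expr (Arg 0)))))) (Arg 1)"

definition prog :: program
  where "prog = [main_body, decide_body, append_body, concat_body, scale_body, atom_body, lin_body,
    val_body, pairs_body, split_body, splits_body, refines_body, refine_body, coords_body, base_body,
    children_body, step_body, levels_body, nonneg_body, sum_body, join_body]"

section \<open>Correctness of the functions\<close>

definition call :: "nat \<Rightarrow> data list \<Rightarrow> data option"
  where "call f vs = run prog vs (prog ! f)"

lemma length_prog [simp]: "length prog = 21"
  by (simp add: prog_def)

lemma run_prog_Call [simp]: "f < 21 \<Longrightarrow>
    run prog env (Call f es) = Option.bind (those (map (run prog env) es)) (call f)"
  by (simp add: run_Call call_def[abs_def])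

lemma call_body:
  "call 1 vs = run prog vs decide_body" "call 2 vs = run prog vs append_body"
  "call 3 vs = run prog vs concat_body" "call 4 vs = run prog vs scale_body"
  "call 5 vs = run prog vs atom_body" "call 6 vs = run prog vs lin_body"
  "call 7 vs = run prog vs val_body" "call 8 vs = run prog vs pairs_body"
  "call 9 vs = run prog vs split_body" "call 10 vs = run prog vs splits_body"
  "call 11 vs = run prog vs refines_body" "call 12 vs = run prog vs refine_body"
  "call 13 vs = run prog vs coords_body" "call 14 vs = run prog vs base_body"
  "call 15 vs = run prog vs children_body" "call 16 vs = run prog vs step_body"
  "call 17 vs = run prog vs levels_body" "call 18 vs = run prog vs nonneg_body"
  "call 19 vs = run prog vs sum_body" "call 20 vs = run prog vs join_body"
  by (simp_all add: call_def prog_def)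

lemma call_append: "call 2 [enc_list xs, enc_list ys] = Some (enc_list (xs @ ys))"
  by (induction xs) (subst call_body; simp add: append_body_def)+

lemma call_append_state [simp]:
  "call 2 [enc_state m, enc_state m'] = Some (enc_state (m @ m'))"
  "call 2 [enc_cone p, enc_cone q] = Some (enc_cone (p @ q))"
  "call 2 [enc_cones ps, enc_cones qs] = Some (enc_cones (ps @ qs))"
  by (simp_all add: enc_state_def enc_cone_def enc_cones_def call_append)

lemma call_concat [simp]: "call 3 [enc_cones ps] = Some (enc_cone (concat ps))"
  by (induction ps) (subst call_body; simp add: concat_body_def)+

lemma call_scale [simp]: "call 4 [Num c, enc_state m] = Some (enc_state (scale c m))"
  by (induction m) (subst call_body; auto simp add: scale_body_def)+

text \<open>The assumption is confined to the atoms of \<open>m\<close>, because in the recursion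
  through children the claim is known only for those.\<close>

lemma call_lin:
  assumes "\<And>a. a \<in> snd ` set m \<Longrightarrow> call 5 [T, enc_atom a] = Some (Num (f a))"
  shows "call 6 [T, enc_state m] = Some (Num (lin f m))"
  using assms by (induction m) (subst call_body; auto simp add: lin_body_def)+

lemma call_atom_coord:
  "call 5 [enc_trm (Var i), enc_atom a] = Some (Num (if a = Coord i then 1 else 0))"
  "call 5 [enc_trm (CoVar i), enc_atom a] = Some (Num (if a = Coord i then 1 else 0))"
  by (cases a; subst call_body; auto simp add: atom_body_def coord_test_expr_def)+

lemma call_atom_mass:
  "call 5 [enc_trm One, enc_atom a] = Some (Num (mass a))"
  "call 5 [enc_trm NegOne, enc_atom a] = Some (Num (mass a))"
proof (induction a)
  case (Child m)
  have "call 6 [enc_trm One, enc_state m] = Some (Num (lin mass m))"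
    "call 6 [enc_trm NegOne, enc_state m] = Some (Num (lin mass m))"
    by (rule call_lin; use Child in fastforce)+
  then show "call 5 [enc_trm One, enc_atom (Child m)] = Some (Num (mass (Child m)))"
    "call 5 [enc_trm NegOne, enc_atom (Child m)] = Some (Num (mass (Child m)))"
    by (subst call_body; simp add: atom_body_def mass_expr_def)+
qed (subst call_body; auto simp add: atom_body_def mass_expr_def)+

lemma call_val [simp]: "call 7 [enc_trm A, enc_state m] = Some (Num (val A m))"
proof (induction A arbitrary: m)
  case (Var i)
  show ?case using call_lin[OF call_atom_coord(1)]
    by (subst call_body) (simp add: val_body_def Let_def)
next
  case (CoVar i)
  show ?case using call_lin[OF call_atom_coord(2)]
    by (subst call_body) (simp add: val_body_def Let_def)
next
  case One
  show ?case using call_lin[OF call_atom_mass(1)]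
    by (subst call_body) (simp add: val_body_def Let_def)
next
  case NegOne
  show ?case using call_lin[OF call_atom_mass(2)]
    by (subst call_body) (simp add: val_body_def Let_def)
next
  case (Dia A)
  let ?f = "\<lambda>a. case a of Child c \<Rightarrow> val A c | _ \<Rightarrow> 0"
  have "call 5 [enc_trm (Dia A), enc_atom a] = Some (Num (?f a))" for a
    using Dia by (subst call_body) (cases a; simp add: atom_body_def child_expr_def)
  from call_lin[OF this] show ?case by (subst call_body) (simp add: val_body_def Let_def)
qed (subst call_body; simp add: val_body_def Let_def)+

lemma call_pairs [simp]:
  "call 8 [enc_trm A, enc_trm B, enc_state g, enc_cone q, enc_cone acc] =
    Some (enc_cone (pairs A B g q acc))"
  by (induction q) (subst call_body; simp add: pairs_body_def Let_def)+

lemma call_split [simp]: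
  "call 9 [enc_trm A, enc_trm B, enc_cone p, enc_cone q] = Some (enc_cone (split_cone A B p q))"
  by (induction p) (subst call_body; simp add: split_body_def Let_def)+

lemma call_splits [simp]:
  "call 10 [enc_trm A, enc_trm B, enc_cones ps] =
    Some (enc_cones (concat (map (\<lambda>q. [split_cone A B q q, split_cone B A q q]) ps)))"
  by (induction ps) (subst call_body; simp add: splits_body_def Let_def)+

text \<open>Functions 11 and 12 call each other; correctness of 12 at \<open>A\<close> is an
  assumption so that the induction on terms in \<open>call_refine\<close> can supply it.\<close>

lemma call_refines:
  assumes "\<And>p. call 12 [enc_trm A, enc_cone p] = Some (enc_cones (refine A p))"
  shows "call 11 [enc_trm A, enc_cones ps] = Some (enc_cones (concat (map (refine A) ps)))"
  by (induction ps) (subst call_body; simp add: refines_body_def assms)+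

lemma call_refine [simp]: "call 12 [enc_trm A, enc_cone p] = Some (enc_cones (refine A p))"
  by (induction A arbitrary: p) (subst call_body; simp add: refine_body_def Let_def call_refines)+

lemma call_coords [simp]: "call 13 [enc_trm A] = Some (enc_cone (coords A))"
  by (induction A) (subst call_body; simp add: coords_body_def Let_def)+

lemma call_base [simp]: "call 14 [enc_trm T] = Some (enc_cone (base T))"
  by (subst call_body) (simp add: base_body_def base_def)

lemma call_children [simp]:
  "call 15 [enc_cone p] = Some (enc_cone (map (\<lambda>g. [(1, Child g)]) p))"
  by (induction p) (subst call_body; simp add: children_body_def)+

lemma call_step [simp]: "call 16 [enc_trm T, enc_cone p] = Some (enc_cone (step T p))"
  by (subst call_body) (simp add: step_body_def step_def)

lemma call_levels [simp]:
  "call 17 [enc_trm A, enc_trm T, enc_cone p] = Some (enc_cone (levels T A p))"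
  by (induction A arbitrary: p) (subst call_body; simp add: levels_body_def Let_def)+

lemma call_nonneg [simp]:
  "call 18 [enc_trm T, enc_cone p] = Some (truth (\<forall>g\<in>set p. val T g \<ge> 0))"
  by (induction p) (subst call_body; simp add: nonneg_body_def truth_def)+

lemma call_sum [simp]: "call 19 [enc_list (map enc_weighted \<Gamma>)] = Some (enc_trm (sum_term \<Gamma>))"
  by (induction \<Gamma>)
    (subst call_body; auto simp add: sum_body_def enc_weighted_def)+

lemma call_join [simp]:
  "call 20 [enc_hyper H, enc_trm A] = Some (enc_trm (join_term H A))"
proof (induction H arbitrary: A)
  case (Cons \<Gamma> H)
  show ?case using Cons[of "Join A (sum_term \<Gamma>)"]
    by (subst call_body) (simp add: join_body_def enc_hyper_def)
qed (subst call_body; simp add: join_body_def enc_hyper_def)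

lemma call_decide [simp]:
  "call 1 [enc_trm T] = Some (truth (\<forall>g\<in>set (generators T). val T g \<ge> 0))"
  by (subst call_body) (simp add: decide_body_def generators_def)

theorem theorem4p13:
  shows "\<exists>P :: program. \<forall>H :: hyperlist. H \<noteq> [] \<longrightarrow>
    computes P (enc_hyper H) (truth (HMR (hyperseq_of H)))"
proof (intro exI[of _ prog] allI impI)
  fix H :: hyperlist
  assume "H \<noteq> []"
  then obtain \<Gamma> H' where H: "H = \<Gamma> # H'" by (cases H) auto
  have "call 20 [enc_list (map (\<lambda>\<Gamma>. enc_list (map enc_weighted \<Gamma>)) H'), enc_trm A] =
      Some (enc_trm (join_term H' A))" for A
    using call_join[of H'] by (simp add: enc_hyper_def)
  then have "run prog [enc_hyper H] main_body = Some (truth (HMR (hyperseq_of H)))"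
    unfolding H HMR_iff_generators using call_decide[unfolded One_nat_def]
    by (simp add: main_body_def enc_hyper_def)
  then show "computes prog (enc_hyper H) (truth (HMR (hyperseq_of H)))"
    by (simp add: computes_def run_eq_Some[symmetric]) (simp add: prog_def)
qed

end
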